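(* Consider the $n$-player stochastic game with separately controlled chains and the decentralized policy-iteration algorithm (Algorithm 1) described in the context. From any initial policy $u^{(0)}\in\mathcal U^{\rm SD}$, the algorithm stops after a finite number of iterations, and the policy $u^*\in\mathcal U^{\rm SD}$ at which it stops is a strictly local minimum or a first-order stationary point of the team variance in the space of mixed policies. Precisely: for every $u'\in\mathcal U^{\rm SD}$, either (i) $u^*$ is a strictly local minimum along the mixing direction $u^*\to u'$, i.e. there is $\delta_0\in(0,1]$ with $J^{\delta^{u'}_{u^*}}_\sigma>J^{u^*}_\sigma$ for all $0<\delta<\delta_0$; or (ii) $u^*$ is first-order stationary along the mixing direction $u^*\to u'$, i.e. $\dfrac{\partial J^{\delta^{u'}_{u^*}}_\sigma}{\partial\delta}\Big|_{\delta=0}=0$ (one-sided derivative).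
   Context: Game. There are players $\mathcal I=\{1,\dots,n\}$. Player $i$ has a finite state space $\mathcal S_i$ and a finite action space $\mathcal A_i$. Time is discrete, $t=0,1,2,\dots$; the state and action of player $i$ at time $t$ are $s_{i,t}$, $a_{i,t}$. Separately controlled chains: player $i$'s state moves according to a transition probability $p_i(s_i'\mid s_i,a_i)$ depending only on its own state and action, player $i$'s reward is $r_i(s_i,a_i)\in\mathbb R$, and the joint transition probability is $\prod_{i=1}^n p_i(s_i'\mid s_i,a_i)$. $\mathcal U_i^{\rm SD}$ is the set of stationary deterministic policies of player $i$, i.e. maps $u_i:\mathcal S_i\to\mathcal A_i$ with $a_{i,t}=u_i(s_{i,t})$, and $\mathcal U^{\rm SD}=\times_{i=1}^n\mathcal U_i^{\rm SD}$. Standing assumption: for every $i$ and $u_i\in\mathcal U_i^{\rm SD}$ the Markov chain on $\mathcal S_i$ with transition probabilities $p_i(s'\mid s,u_i(s))$ is ergodic (irreducible and aperiodic). Criterion. The team mean and team variance under a stationary (possibly randomized) policy $u$ are $$\mu^u=\mathbb E^u\Big\{\frac1n\sum_{i=1}^n\lim_{T\to\infty}\frac1T\sum_{t=0}^{T-1}r_i(s_{i,t},a_{i,t})\Big\},\qquad J^u_\sigma=\mathbb E^u\Big\{\sum_{i=1}^n\lim_{T\to\infty}\frac1T\sum_{t=0}^{T-1}[r_i(s_{i,t},a_{i,t})-\mu^u]^2\Big\}.$$ Mixed policies. For $u,u'\in\mathcal U^{\rm SD}$ and $0\le\delta\le1$, $\delta^{u'}_u$ is the stationary randomized policy under which, at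 each time $t$, each player $i$, independently of the other players and of the past, uses action $u_i(s_{i,t})$ with probability $1-\delta$ and $u'_i(s_{i,t})$ with probability $\delta$. Performance potential. For $u_i\in\mathcal U_i^{\rm SD}$ and parameter $y\in\mathbb R$, $$g_i^{u_i}(s)=\mathbb E\Big\{\sum_{t=0}^\infty\big([r_i(s_{i,t},a_{i,t})-y]^2-J^{u_i}_{\sigma,i}(y)\big)\,\Big|\,s_{i,0}=s\Big\},\qquad s\in\mathcal S_i,\ a_{i,t}=u_i(s_{i,t}),$$ where $J^{u_i}_{\sigma,i}(y)=\mathbb E^{u_i}\{\lim_{T\to\infty}\frac1T\sum_{t=0}^{T-1}[r_i(s_{i,t},a_{i,t})-y]^2\}$. The infinite sum is understood as the limit of the expectations of its partial sums. Algorithm 1. Start with an arbitrary $u^{(0)}\in\mathcal U^{\rm SD}$ and $l=0$. At iteration $l$: (evaluation) compute $\mu^{u^{(l)}}$ and, for each $i$, $g_i^{u_i^{(l)}}$ with $y=\mu^{u^{(l)}}$; (improvement) for each $i\in\mathcal I$ and each $s\in\mathcal S_i$ set $$u_i^{(l+1)}(s)\in\operatorname*{arg\,min}_{a\in\mathcal A_i}\Big\{(r_i(s,a)-\mu^{u^{(l)}})^2+\sum_{s'\in\mathcal S_i}p_i(s'\mid s,a)\,g_i^{u_i^{(l)}}(s')\Big\},$$ choosing $u_i^{(l+1)}(s)=u_i^{(l)}(s)$ whenever $u_i^{(l)}(s)$ is one of the minimizers (otherwise any minimizer). If $u^{(l+1)}=u^{(l)}$, stop; otherwise replace $l$ by $l+1$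 and repeat. All quantities are computed exactly. *)

theory Defs
  imports "HOL-Probability.Probability"
begin

section \<open>Path laws of discrete Markov chains\<close>

definition chain_kernel ::
    "'x pmf \<Rightarrow> ('x \<Rightarrow> 'x pmf) \<Rightarrow> nat \<Rightarrow> (nat \<Rightarrow> 'x) \<Rightarrow> 'x measure" where
  "chain_kernel \<nu> K t \<omega> = measure_pmf (case t of 0 \<Rightarrow> \<nu> | Suc t' \<Rightarrow> K (\<omega> t'))"

interpretation chain: Ionescu_Tulcea "chain_kernel \<nu> K" "\<lambda>_. count_space UNIV"
  for \<nu> :: "'x pmf" and K :: "'x \<Rightarrow> 'x pmf"
proof (rule Ionescu_Tulcea.intro)
  show "chain_kernel \<nu> K t
      \<in> PiM {0..<t} (\<lambda>_. count_space UNIV) \<rightarrow>\<^sub>M subprob_algebra (count_space UNIV)" for t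
  proof (cases t)
    case 0
    then show ?thesis
      by (simp add: chain_kernel_def[abs_def] measure_pmf_in_subprob_algebra)
  next
    case (Suc t')
    have "(\<lambda>x. measure_pmf (K x)) \<in> count_space UNIV \<rightarrow>\<^sub>M subprob_algebra (count_space UNIV)"
      by (simp add: measure_pmf_in_subprob_algebra)
    moreover have "(\<lambda>\<omega>. \<omega> t') \<in> PiM {0..<t} (\<lambda>_. count_space UNIV) \<rightarrow>\<^sub>M count_space (UNIV :: 'x set)"
      using Suc by (intro measurable_component_singleton) auto
    ultimately have "(\<lambda>\<omega>. measure_pmf (K (\<omega> t')))
        \<in> PiM {0..<t} (\<lambda>_. count_space UNIV) \<rightarrow>\<^sub>M subprob_algebra (count_space UNIV)"
      using measurable_compose by blast
    then show ?thesis
      using Suc by (simp add: chain_kernel_def[abs_def])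
  qed
  show "prob_space (chain_kernel \<nu> K t \<omega>)" for t \<omega>
    unfolding chain_kernel_def by (rule prob_space_measure_pmf)
qed

text \<open>The law of the trajectory $(x_0, x_1, \dots)$ with $x_0 \sim \nu$ and
  $x_{t+1} \sim K(x_t)$ given the past (Ionescu-Tulcea).\<close>

definition path_law :: "'x pmf \<Rightarrow> ('x \<Rightarrow> 'x pmf) \<Rightarrow> (nat \<Rightarrow> 'x) measure" where
  "path_law \<nu> K = chain.PF.lim \<nu> K"

lemma prob_space_path_law: "prob_space (path_law \<nu> K)"
proof (rule prob_space_distrD)
  show "(\<lambda>\<omega>. restrict \<omega> {}) \<in> path_law \<nu> K \<rightarrow>\<^sub>M PiM {} (\<lambda>_. count_space UNIV)"
    unfolding path_law_def by (simp add: measurable_cong_sets[OF chain.PF.sets_lim refl])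
  show "prob_space (distr (path_law \<nu> K) (PiM {} (\<lambda>_. count_space UNIV)) (\<lambda>\<omega>. restrict \<omega> {}))"
    unfolding path_law_def
    by (subst chain.distr_lim) (auto intro!: chain.PF.prob_space_P)
qed

lemma sets_path_law: "sets (path_law \<nu> K) = sets (PiM UNIV (\<lambda>_. count_space UNIV))"
  unfolding path_law_def by simp

lemma emeasure_path_law_cylinder:
  "emeasure (path_law \<nu> K) {\<omega>. \<forall>t\<le>T. \<omega> t = x t} =
     ennreal (pmf \<nu> (x 0) * (\<Prod>t<T. pmf (K (x t)) (x (Suc t))))"
proof -
  let ?M = "\<lambda>_::nat. count_space (UNIV :: 'a set)"
  let ?r = "\<lambda>n. restrict x {0..<n}"
  let ?q = "\<lambda>t. pmf (case t of 0 \<Rightarrow> \<nu> | Suc t' \<Rightarrow> K (x t')) (x t)"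
  have r: "{?r n} = PiE {0..<n} (\<lambda>t. {x t})" for n
    by (auto simp: PiE_def extensional_def fun_eq_iff restrict_def Pi_def)
  have r_sets [measurable]: "{?r n} \<in> sets (PiM {0..<n} ?M)" for n
    unfolding r by (intro sets_PiM_I_finite) auto
  have C: "emeasure (chain.C \<nu> K 0 n (\<lambda>_. undefined)) {?r n} = ennreal (\<Prod>t<n. ?q t)" for n
  proof (induction n)
    case 0
    show ?case
      by (simp add: PiM_empty restrict_def)
  next
    case (Suc n)
    let ?C = "chain.C \<nu> K 0 n (\<lambda>_. undefined)"
    have spC: "space ?C = space (PiM {0..<n} ?M)"
      using chain.space_C[of "\<lambda>_. undefined" 0] by simp
    have setsC: "sets ?C = sets (PiM {0..<n} ?M)"
      using chain.sets_C[of "\<lambda>_. undefined" 0] by simp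
    have eP: "emeasure (chain.eP \<nu> K n \<omega>) {?r (Suc n)} = ennreal (?q n) * indicator {?r n} \<omega>"
      if "\<omega> \<in> space (PiM {0..<n} ?M)" for \<omega>
    proof -
      have ext: "\<omega> t = undefined" if "t \<notin> {0..<n}" for t
        using \<open>\<omega> \<in> space _\<close> that by (auto simp: space_PiM PiE_def extensional_def)
      have *: "fun_upd \<omega> n z = ?r (Suc n) \<longleftrightarrow> \<omega> = ?r n \<and> z = x n" for z
      proof
        assume h: "fun_upd \<omega> n z = ?r (Suc n)"
        have "\<omega> t = ?r n t" for t
          using fun_cong[OF h, of t] ext[of t] by (cases "t = n") (auto simp: less_Suc_eq)
        then show "\<omega> = ?r n \<and> z = x n"
          using fun_cong[OF h, of n] by auto
      qed (auto simp: fun_eq_iff)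
      have "emeasure (chain.eP \<nu> K n \<omega>) {?r (Suc n)} =
          chain_kernel \<nu> K n \<omega> (fun_upd \<omega> n -` {?r (Suc n)} \<inter> space (count_space UNIV))"
        using that r_sets by (rule chain.emeasure_eP)
      also have "fun_upd \<omega> n -` {?r (Suc n)} \<inter> space (count_space UNIV)
          = (if \<omega> = ?r n then {x n} else {})"
        using * by auto
      also have "chain_kernel \<nu> K n \<omega> \<dots> = ennreal (?q n) * indicator {?r n} \<omega>"
        by (cases n) (auto simp: chain_kernel_def emeasure_pmf_single)
      finally show ?thesis .
    qed
    have "emeasure (chain.C \<nu> K 0 (Suc n) (\<lambda>_. undefined)) {?r (Suc n)} =
        (\<integral>\<^sup>+\<omega>. emeasure (chain.eP \<nu> K n \<omega>) {?r (Suc n)} \<partial>?C)"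
      using chain.measurable_eP[of \<nu> K n] r_sets[of "Suc n"]
      by (simp, subst emeasure_bind[where N = "PiM {0..<Suc n} ?M"])
         (auto simp: spC measurable_cong_sets[OF setsC refl] space_PiM PiE_eq_empty_iff)
    also have "\<dots> = (\<integral>\<^sup>+\<omega>. ennreal (?q n) * indicator {?r n} \<omega> \<partial>?C)"
      by (intro nn_integral_cong eP) (simp add: spC)
    also have "\<dots> = ennreal (?q n) * emeasure ?C {?r n}"
      using r_sets[of n] by (subst nn_integral_cmult_indicator) (simp_all add: setsC)
    also have "\<dots> = ennreal (\<Prod>t<Suc n. ?q t)"
      by (simp add: Suc ennreal_mult[symmetric] prod_nonneg mult.commute)
    finally show ?case .
  qed
  have "{\<omega>. \<forall>t\<le>T. \<omega> t = x t} = prod_emb UNIV ?M {0..<Suc T} {?r (Suc T)}"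
    by (auto simp: prod_emb_def space_PiM fun_eq_iff less_Suc_eq_le restrict_def) metis
  then have "emeasure (path_law \<nu> K) {\<omega>. \<forall>t\<le>T. \<omega> t = x t} =
      emeasure (chain.CI \<nu> K {0..<Suc T}) {?r (Suc T)}"
    unfolding path_law_def using r_sets[of "Suc T"] by (simp only: chain.lim finite_atLeastLessThan)
  also have "\<dots> = emeasure (chain.C \<nu> K 0 (Suc T) (\<lambda>_. undefined))
      (prod_emb {0..<Suc T} ?M {0..<Suc T} {?r (Suc T)})"
    using r_sets[of "Suc T"] by (rule chain.emeasure_CI[OF subset_refl])
  also have "prod_emb {0..<Suc T} ?M {0..<Suc T} {?r (Suc T)} = {?r (Suc T)}"
    using sets.sets_into_space[OF r_sets[of "Suc T"]] by (intro prod_emb_id) (auto simp: space_PiM)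
  also have "emeasure (chain.C \<nu> K 0 (Suc T) (\<lambda>_. undefined)) {?r (Suc T)} = ennreal (\<Prod>t<Suc T. ?q t)"
    by (rule C)
  also have "(\<Prod>t<Suc T. ?q t) = pmf \<nu> (x 0) * (\<Prod>t<T. pmf (K (x t)) (x (Suc t)))"
    by (subst prod.lessThan_Suc_shift) simp
  finally show ?thesis .
qed

text \<open>A pathwise limit. It is arbitrary on trajectories where the averages diverge, which form a
  null set for the finite chains considered below.\<close>

definition long_run_average :: "(nat \<Rightarrow> real) \<Rightarrow> real" where
  "long_run_average c = lim (\<lambda>T. (\<Sum>t<T. c t) / real T)"


section \<open>Ergodic finite chains\<close>

primrec n_step :: "('x \<Rightarrow> 'x pmf) \<Rightarrow> nat \<Rightarrow> 'x \<Rightarrow> 'x pmf" where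
  "n_step K 0 x = return_pmf x"
| "n_step K (Suc m) x = bind_pmf (n_step K m x) K"

definition irreducible_on :: "'x set \<Rightarrow> ('x \<Rightarrow> 'x pmf) \<Rightarrow> bool" where
  "irreducible_on S K \<longleftrightarrow> (\<forall>x\<in>S. \<forall>y\<in>S. \<exists>m. pmf (n_step K m x) y > 0)"

definition aperiodic_on :: "'x set \<Rightarrow> ('x \<Rightarrow> 'x pmf) \<Rightarrow> bool" where
  "aperiodic_on S K \<longleftrightarrow> (\<forall>x\<in>S. Gcd {m. m > 0 \<and> pmf (n_step K m x) x > 0} = 1)"


section \<open>Games with separately controlled chains\<close>

record ('s, 'a) game =
  num_players :: nat
  states :: "nat \<Rightarrow> 's set"
  actions :: "nat \<Rightarrow> 'a set"
  trans_prob :: "nat \<Rightarrow> 's \<Rightarrow> 'a \<Rightarrow> 's pmf"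
  reward :: "nat \<Rightarrow> 's \<Rightarrow> 'a \<Rightarrow> real"

definition players :: "('s, 'a) game \<Rightarrow> nat set" where
  "players G = {1..num_players G}"

definition valid_game :: "('s, 'a) game \<Rightarrow> bool" where
  "valid_game G \<longleftrightarrow> num_players G \<ge> 1 \<and>
    (\<forall>i\<in>players G. finite (states G i) \<and> states G i \<noteq> {} \<and>
       finite (actions G i) \<and> actions G i \<noteq> {} \<and>
       (\<forall>s\<in>states G i. \<forall>a\<in>actions G i. set_pmf (trans_prob G i s a) \<subseteq> states G i))"

definition joint_states :: "('s, 'a) game \<Rightarrow> (nat \<Rightarrow> 's) set" where
  "joint_states G = (\<Pi>\<^sub>E i\<in>players G. states G i)"

text \<open>Extensional functions, so that equality of policies means agreement on the state spaces.\<close>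

definition SD_policies :: "('s, 'a) game \<Rightarrow> (nat \<Rightarrow> 's \<Rightarrow> 'a) set" where
  "SD_policies G = (\<Pi>\<^sub>E i\<in>players G. states G i \<rightarrow>\<^sub>E actions G i)"

definition ergodic_game :: "('s, 'a) game \<Rightarrow> bool" where
  "ergodic_game G \<longleftrightarrow> (\<forall>i\<in>players G. \<forall>v \<in> states G i \<rightarrow>\<^sub>E actions G i.
     irreducible_on (states G i) (\<lambda>s. trans_prob G i s (v s)) \<and>
     aperiodic_on (states G i) (\<lambda>s. trans_prob G i s (v s)))"


section \<open>Team mean and team variance\<close>

text \<open>A stationary, possibly randomized, policy maps a joint state to a distribution
  on joint actions.\<close>

type_synonym ('s, 'a) stationary_policy = "(nat \<Rightarrow> 's) \<Rightarrow> (nat \<Rightarrow> 'a) pmf"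

definition det_policy ::
    "('s, 'a) game \<Rightarrow> (nat \<Rightarrow> 's \<Rightarrow> 'a) \<Rightarrow> ('s, 'a) stationary_policy" where
  "det_policy G u s = return_pmf (\<lambda>i\<in>players G. u i (s i))"

definition mixed_policy ::
    "('s, 'a) game \<Rightarrow> real \<Rightarrow> (nat \<Rightarrow> 's \<Rightarrow> 'a) \<Rightarrow> (nat \<Rightarrow> 's \<Rightarrow> 'a) \<Rightarrow> ('s, 'a) stationary_policy" where
  "mixed_policy G \<delta> u u' s =
     Pi_pmf (players G) undefined
       (\<lambda>i. map_pmf (\<lambda>b. if b then u' i (s i) else u i (s i)) (bernoulli_pmf \<delta>))"

text \<open>The chain of pairs (joint state, joint action), and its law when the initial joint state
  has distribution \<open>\<nu>\<close>.\<close>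

definition joint_step ::
    "('s, 'a) game \<Rightarrow> ('s, 'a) stationary_policy
      \<Rightarrow> (nat \<Rightarrow> 's) \<times> (nat \<Rightarrow> 'a) \<Rightarrow> ((nat \<Rightarrow> 's) \<times> (nat \<Rightarrow> 'a)) pmf" where
  "joint_step G d = (\<lambda>(s, a).
     bind_pmf (Pi_pmf (players G) undefined (\<lambda>i. trans_prob G i (s i) (a i)))
       (\<lambda>s'. map_pmf (Pair s') (d s')))"

definition play_law ::
    "('s, 'a) game \<Rightarrow> (nat \<Rightarrow> 's) pmf \<Rightarrow> ('s, 'a) stationary_policy
      \<Rightarrow> (nat \<Rightarrow> (nat \<Rightarrow> 's) \<times> (nat \<Rightarrow> 'a)) measure" where
  "play_law G \<nu> d = path_law (bind_pmf \<nu> (\<lambda>s. map_pmf (Pair s) (d s))) (joint_step G d)"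

definition reward_at ::
    "('s, 'a) game \<Rightarrow> nat \<Rightarrow> nat \<Rightarrow> (nat \<Rightarrow> (nat \<Rightarrow> 's) \<times> (nat \<Rightarrow> 'a)) \<Rightarrow> real" where
  "reward_at G i t \<omega> = reward G i (fst (\<omega> t) i) (snd (\<omega> t) i)"

definition team_mean ::
    "('s, 'a) game \<Rightarrow> (nat \<Rightarrow> 's) pmf \<Rightarrow> ('s, 'a) stationary_policy \<Rightarrow> real" where
  "team_mean G \<nu> d =
     (\<integral>\<omega>. 1 / real (num_players G) *
         (\<Sum>i\<in>players G. long_run_average (\<lambda>t. reward_at G i t \<omega>)) \<partial>play_law G \<nu> d)"

definition team_variance ::
    "('s, 'a) game \<Rightarrow> (nat \<Rightarrow> 's) pmf \<Rightarrow> ('s, 'a) stationary_policy \<Rightarrow> real" where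
  "team_variance G \<nu> d =
     (\<integral>\<omega>. (\<Sum>i\<in>players G.
         long_run_average (\<lambda>t. (reward_at G i t \<omega> - team_mean G \<nu> d)\<^sup>2)) \<partial>play_law G \<nu> d)"


section \<open>Performance potentials\<close>

text \<open>The chain of pairs (state, action) of player \<open>i\<close> alone under the policy \<open>v\<close>, with
  initial state distribution \<open>q\<close>.\<close>

definition player_law ::
    "('s, 'a) game \<Rightarrow> nat \<Rightarrow> ('s \<Rightarrow> 'a) \<Rightarrow> 's pmf \<Rightarrow> (nat \<Rightarrow> 's \<times> 'a) measure" where
  "player_law G i v q =
     path_law (map_pmf (\<lambda>s. (s, v s)) q)
       (\<lambda>(s, a). map_pmf (\<lambda>s'. (s', v s')) (trans_prob G i s a))"

definition sq_dev :: "('s, 'a) game \<Rightarrow> nat \<Rightarrow> real \<Rightarrow> 's \<times> 'a \<Rightarrow> real" where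
  "sq_dev G i y = (\<lambda>(s, a). (reward G i s a - y)\<^sup>2)"

definition pseudo_variance ::
    "('s, 'a) game \<Rightarrow> (nat \<Rightarrow> 's) pmf \<Rightarrow> nat \<Rightarrow> ('s \<Rightarrow> 'a) \<Rightarrow> real \<Rightarrow> real" where
  "pseudo_variance G \<nu> i v y =
     (\<integral>\<omega>. long_run_average (\<lambda>t. sq_dev G i y (\<omega> t)) \<partial>player_law G i v (map_pmf (\<lambda>s. s i) \<nu>))"

definition potential ::
    "('s, 'a) game \<Rightarrow> (nat \<Rightarrow> 's) pmf \<Rightarrow> nat \<Rightarrow> ('s \<Rightarrow> 'a) \<Rightarrow> real \<Rightarrow> 's \<Rightarrow> real" where
  "potential G \<nu> i v y s =
     lim (\<lambda>T. \<integral>\<omega>. (\<Sum>t<T. sq_dev G i y (\<omega> t) - pseudo_variance G \<nu> i v y)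
              \<partial>player_law G i v (return_pmf s))"


section \<open>The policy iteration\<close>

definition improvement_value ::
    "('s, 'a) game \<Rightarrow> (nat \<Rightarrow> 's) pmf \<Rightarrow> (nat \<Rightarrow> 's \<Rightarrow> 'a) \<Rightarrow> nat \<Rightarrow> 's \<Rightarrow> 'a \<Rightarrow> real" where
  "improvement_value G \<nu> u i s a =
     (let y = team_mean G \<nu> (det_policy G u) in
       (reward G i s a - y)\<^sup>2 +
       (\<Sum>s'\<in>states G i. pmf (trans_prob G i s a) s' * potential G \<nu> i (u i) y s'))"

definition minimizers ::
    "('s, 'a) game \<Rightarrow> (nat \<Rightarrow> 's) pmf \<Rightarrow> (nat \<Rightarrow> 's \<Rightarrow> 'a) \<Rightarrow> nat \<Rightarrow> 's \<Rightarrow> 'a set" where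
  "minimizers G \<nu> u i s =
     {a. is_arg_min (improvement_value G \<nu> u i s) (\<lambda>a. a \<in> actions G i) a}"

definition improvements ::
    "('s, 'a) game \<Rightarrow> (nat \<Rightarrow> 's) pmf \<Rightarrow> (nat \<Rightarrow> 's \<Rightarrow> 'a) \<Rightarrow> (nat \<Rightarrow> 's \<Rightarrow> 'a) set" where
  "improvements G \<nu> u =
     {w \<in> SD_policies G. \<forall>i\<in>players G. \<forall>s\<in>states G i.
        w i s \<in> minimizers G \<nu> u i s \<and>
        (u i s \<in> minimizers G \<nu> u i s \<longrightarrow> w i s = u i s)}"

text \<open>\<open>U l\<close> is the \<open>l\<close>-th iterate; entries after the stopping index are irrelevant and
  left unconstrained.\<close>

definition algorithm_run ::
    "('s, 'a) game \<Rightarrow> (nat \<Rightarrow> 's) pmf \<Rightarrow> (nat \<Rightarrow> nat \<Rightarrow> 's \<Rightarrow> 'a) \<Rightarrow> bool" where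
  "algorithm_run G \<nu> U \<longleftrightarrow> U 0 \<in> SD_policies G \<and>
     (\<forall>l. (\<forall>k<l. U (Suc k) \<noteq> U k) \<longrightarrow> U (Suc l) \<in> improvements G \<nu> (U l))"

definition stops_at :: "(nat \<Rightarrow> nat \<Rightarrow> 's \<Rightarrow> 'a) \<Rightarrow> nat \<Rightarrow> bool" where
  "stops_at U L \<longleftrightarrow> U (Suc L) = U L \<and> (\<forall>k<L. U (Suc k) \<noteq> U k)"

lemma improvements_nonempty:
  assumes "valid_game G"
  shows "improvements G \<nu> u \<noteq> {}"
proof -
  define w where "w = (\<lambda>i\<in>players G. \<lambda>s\<in>states G i.
     if u i s \<in> minimizers G \<nu> u i s then u i s else (SOME a. a \<in> minimizers G \<nu> u i s))"
  have "minimizers G \<nu> u i s \<noteq> {}" if "i \<in> players G" for i s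
    using assms that ex_is_arg_min_if_finite[of "actions G i" "improvement_value G \<nu> u i s"]
    by (auto simp: valid_game_def minimizers_def)
  then have w: "w i s \<in> minimizers G \<nu> u i s" if "i \<in> players G" "s \<in> states G i" for i s
    using that by (auto simp: w_def some_in_eq)
  then have "w i s \<in> actions G i" if "i \<in> players G" "s \<in> states G i" for i s
    using that by (force simp: minimizers_def is_arg_min_def)
  then have "w \<in> SD_policies G"
    by (auto simp: SD_policies_def w_def)
  with w have "w \<in> improvements G \<nu> u"
    by (auto simp: improvements_def w_def)
  then show ?thesis by blast
qed

lemma algorithm_run_exists:
  assumes "valid_game G" "u0 \<in> SD_policies G"
  shows "\<exists>U. algorithm_run G \<nu> U \<and> U 0 = u0"
proof -
  define U where "U = rec_nat u0 (\<lambda>_ u. SOME w. w \<in> improvements G \<nu> u)"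
  have "U (Suc l) \<in> improvements G \<nu> (U l)" for l
    using improvements_nonempty[OF assms(1)] by (simp add: U_def some_in_eq)
  then show ?thesis
    using assms(2) by (intro exI[of _ U]) (auto simp: algorithm_run_def U_def)
qed


section \<open>Behaviour along a mixing direction\<close>

definition strict_local_min_along ::
    "('s, 'a) game \<Rightarrow> (nat \<Rightarrow> 's) pmf \<Rightarrow> (nat \<Rightarrow> 's \<Rightarrow> 'a) \<Rightarrow> (nat \<Rightarrow> 's \<Rightarrow> 'a) \<Rightarrow> bool" where
  "strict_local_min_along G \<nu> u u' \<longleftrightarrow>
     (\<exists>\<delta>0. 0 < \<delta>0 \<and> \<delta>0 \<le> 1 \<and> (\<forall>\<delta>. 0 < \<delta> \<and> \<delta> < \<delta>0 \<longrightarrow>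
        team_variance G \<nu> (mixed_policy G \<delta> u u') > team_variance G \<nu> (det_policy G u)))"

definition stationary_along ::
    "('s, 'a) game \<Rightarrow> (nat \<Rightarrow> 's) pmf \<Rightarrow> (nat \<Rightarrow> 's \<Rightarrow> 'a) \<Rightarrow> (nat \<Rightarrow> 's \<Rightarrow> 'a) \<Rightarrow> bool" where
  "stationary_along G \<nu> u u' \<longleftrightarrow>
     ((\<lambda>\<delta>. team_variance G \<nu> (mixed_policy G \<delta> u u')) has_real_derivative 0) (at 0 within {0..1})"

end

theory Submission
  imports Defs "HOL-Library.Discrete_Functions"
begin

text \<open>
  The players' chains are controlled separately and the mixing coins are independent, so under the
  policy $\delta$-mixed between $u$ and $u'$ each pair $(s_i, a_i)$ is a Markov chain of its own, and
  every long-run average is a stationary average $L_i^\delta$ of that chain. The variance is not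
  an average cost because it contains the mean of the whole team. Freezing the mean at the value
  $y$ which it has under $u$ repairs this: expanding the square gives
  \[ J^\delta = \sum_i L_i^\delta\big((r_i - y)^2\big) - n\,(\mu^\delta - y)^2 , \]
  (\<open>variance_about\<close>), and the sum on the right is a genuine average cost. Inserting the Poisson
  equation of the potentials under $u$ turns it into
  \[ J^\delta - J^u = \delta\, A(\delta) - n\,(\mu^\delta - y)^2, \qquad
     A(\delta) = \sum_i \pi_i^\delta\big(Q_i(\cdot, u'_i) - Q_i(\cdot, u_i)\big), \]
  where $Q_i$ is the quantity minimised in the improvement step and $\pi_i^\delta$ is the stationary
  distribution (\<open>variance_difference\<close>, which also covers $\delta = 0$ with a policy other than $u$).

  Termination: for an improved policy all the differences of $Q$ are nonpositive, and one of them is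
  negative at a state of positive stationary probability; the quadratic correction only helps. So
  the variance strictly decreases along the run (\<open>improvement_decreases_variance\<close>), and there are
  finitely many policies.

  Optimality: at the stopping policy every $Q_i(\cdot, u'_i) - Q_i(\cdot, u_i)$ is nonnegative. If all
  of them vanish, then $J^\delta - J^u = - n (\mu^\delta - y)^2$, which is of order $\delta^2$ since the
  mean is Lipschitz in $\delta$ (\<open>mean_lipschitz\<close>), and the derivative at $0$ is $0$. If one is
  positive, then $A(\delta) \ge \kappa > 0$ for all small $\delta$, and the term $\delta\,\kappa$ beats the
  quadratic one. The constant $\kappa$ comes from a Doeblin minorization that is uniform in
  $\delta \le 1/2$ (\<open>uniform_minorization\<close>): a mixed chain follows the chain of $u$ at
  each step with probability at least $1/2$.

  Two results connect this calculation with the definitions by trajectories. The minorization makes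
  the powers of a transition matrix converge summably, which yields the stationary averages and
  the potentials as limits (\<open>Pn_tendsto\<close>, \<open>poisson_equation\<close>). And the pathwise averages converge
  almost surely by a strong law (\<open>strong_law\<close>): the Poisson equation writes a centred sum as a
  martingale with bounded increments plus a telescoping term. Since that law needs only some
  solution of a Poisson equation, it applies directly to the joint chain, with a solution built from
  the chain of one player (\<open>joint_long_run\<close>).
\<close>

section \<open>Primitivity of irreducible aperiodic chains\<close>

text \<open>The smallest positive difference \<open>d = (a + d) - a\<close> of two elements divides every element \<open>e\<close>: with
  \<open>q = e div d\<close>, the elements \<open>(q + 1) * a + e\<close> and \<open>(q + 1) * a + q * d\<close> differ by \<open>e mod d < d\<close>.
  Hence \<open>d = 1\<close>, and from two consecutive elements \<open>a\<close>, \<open>a + 1\<close> all large numbers arise.\<close>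
lemma additive_semigroup_eventually:
  fixes R :: "nat set"
  assumes add: "\<And>a b. a \<in> R \<Longrightarrow> b \<in> R \<Longrightarrow> a + b \<in> R" and gcd: "Gcd R = 1"
  shows "\<exists>N. \<forall>n\<ge>N. n \<in> R"
proof -
  define D where "D = {d. d > 0 \<and> (\<exists>a\<in>R. a + d \<in> R)}"
  obtain r where r: "r \<in> R" "r > 0"
    using gcd by (metis Gcd_0_iff gr0I singletonI subsetI zero_neq_one)
  have mult: "k * a \<in> R" if "a \<in> R" "k > 0" for k a
    using that(2)
  proof (induction k rule: nat_induct_non_zero)
    case (Suc k) then show ?case using add[OF that(1)] by simp
  qed (use that in simp)
  have "r \<in> D" using r add by (auto simp: D_def)
  define d where "d = (LEAST d. d \<in> D)"
  have "d \<in> D" unfolding d_def using \<open>r \<in> D\<close> by (rule LeastI)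
  have least: "d \<le> e" if "e \<in> D" for e unfolding d_def using that by (rule Least_le)
  obtain a where a: "d > 0" "a \<in> R" "a + d \<in> R" using \<open>d \<in> D\<close> by (auto simp: D_def)
  have "d dvd e" if "e \<in> R" for e
  proof (rule ccontr)
    assume "\<not> d dvd e"
    then have pos: "e mod d > 0" by (simp add: dvd_eq_mod_eq_0)
    define q where "q = e div d"
    have "(q + 1) * a + e \<in> R" by (intro add mult a that) auto
    moreover have base: "(q + 1) * a + q * d \<in> R"
    proof (cases "q = 0")
      case False
      have "q * (a + d) + a \<in> R" using False by (intro add mult a) auto
      then show ?thesis by (simp add: algebra_simps)
    qed (use a in simp)
    moreover have "e = q * d + e mod d" by (simp add: q_def)
    ultimately have "(q + 1) * a + q * d + e mod d \<in> R" by (metis add.assoc)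
    then have "e mod d \<in> D" using pos base unfolding D_def by blast
    then show False using least a(1) by (meson mod_less_divisor not_le)
  qed
  then have "d dvd Gcd R" by (rule Gcd_greatest)
  then have "d = 1" using gcd by simp
  \<comment> \<open>With \<open>n = q a + t\<close> and \<open>t < a\<close>, replacing \<open>t\<close> of the summands \<open>a\<close> by \<open>a + 1\<close> needs \<open>q > t\<close>.\<close>
  have "n \<in> R" if n: "n \<ge> (a + 1) * (a + 1)" for n
  proof (cases "a = 0")
    case True
    then have "1 \<in> R" using a \<open>d = 1\<close> by simp
    then show ?thesis using mult[of 1 n] n by simp
  next
    case False
    define q where "q = n div a"
    define t where "t = n mod a"
    have nq: "n = q * a + t" by (simp add: q_def t_def)
    have t: "t < a" using False by (simp add: t_def)
    have "a < q"
    proof (rule ccontr)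
      assume "\<not> a < q"
      then have "q * a \<le> a * a" by simp
      then have "n < a * a + a" using nq t by linarith
      moreover have "a * a + a \<le> (a + 1) * (a + 1)" by simp
      ultimately show False using n by linarith
    qed
    then have qt: "q > t" using t by simp
    have "(q - t) * a \<in> R" using qt by (intro mult a) auto
    moreover have eq: "n = (q - t) * a + t * (a + 1)"
      using nq qt by (simp add: algebra_simps diff_mult_distrib)
    moreover have "t > 0 \<Longrightarrow> t * (a + 1) \<in> R" using a \<open>d = 1\<close> by (intro mult) auto
    ultimately show ?thesis using add by (cases "t = 0") auto
  qed
  then show ?thesis by blast
qed

lemma n_step_add: "n_step K (a + b) x = bind_pmf (n_step K a x) (n_step K b)"
  by (induction b) (simp_all add: bind_return_pmf' bind_assoc_pmf)

text \<open>Aperiodicity gives returns to \<open>x\<close> at all large times, irreducibility a path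
  from \<open>x\<close> to \<open>y\<close>; finitely many thresholds have a common upper bound.\<close>
lemma primitive_chain:
  assumes fin: "finite S" and irr: "irreducible_on S K" and aper: "aperiodic_on S K"
  shows "\<exists>m. \<forall>x\<in>S. \<forall>y\<in>S. pmf (n_step K m x) y > 0"
proof -
  have pos: "pmf (n_step K m x) y > 0 \<longleftrightarrow> y \<in> set_pmf (n_step K m x)" for m x y
    by (simp add: pmf_positive_iff)
  have comp: "z \<in> set_pmf (n_step K (a + b) x)"
    if "y \<in> set_pmf (n_step K a x)" "z \<in> set_pmf (n_step K b y)" for a b x y z
    using that by (auto simp: n_step_add)
  have "\<exists>N. \<forall>n\<ge>N. y \<in> set_pmf (n_step K n x)" if S: "x \<in> S" "y \<in> S" for x y
  proof -
    let ?R = "{m. m > 0 \<and> pmf (n_step K m x) x > 0}"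
    have "\<exists>N. \<forall>n\<ge>N. n \<in> ?R"
    proof (rule additive_semigroup_eventually)
      show "a + b \<in> ?R" if "a \<in> ?R" "b \<in> ?R" for a b
        using comp[of x a x x b] that unfolding pos by simp
      show "Gcd ?R = 1" using aper \<open>x \<in> S\<close> unfolding aperiodic_on_def by blast
    qed
    then obtain N where N: "\<forall>n\<ge>N. n \<in> ?R" ..
    obtain k where "y \<in> set_pmf (n_step K k x)"
      using irr S unfolding irreducible_on_def pos by blast
    then have "y \<in> set_pmf (n_step K n x)" if "n \<ge> N + k" for n
    proof -
      have "x \<in> set_pmf (n_step K (n - k) x)" using N that by (auto simp: pos)
      from comp[OF this \<open>y \<in> set_pmf (n_step K k x)\<close>] show ?thesis using that by simp
    qed
    then show ?thesis by blast
  qed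
  then obtain N where N: "\<And>x y n. x \<in> S \<Longrightarrow> y \<in> S \<Longrightarrow> n \<ge> N x y \<Longrightarrow> y \<in> set_pmf (n_step K n x)"
    by metis
  define m where "m = (\<Sum>x\<in>S. \<Sum>y\<in>S. N x y)"
  have "N x y \<le> m" if "x \<in> S" "y \<in> S" for x y
  proof -
    have "N x y \<le> (\<Sum>y\<in>S. N x y)" by (rule member_le_sum) (use fin that in auto)
    also have "\<dots> \<le> m" unfolding m_def
      by (rule member_le_sum[where f = "\<lambda>x. \<Sum>y\<in>S. N x y"]) (use fin that in auto)
    finally show ?thesis .
  qed
  then show ?thesis using N pos by blast
qed

section \<open>Stationary averages and the Poisson equation\<close>

locale stochastic_matrix =
  fixes S :: "'s set" and w :: "'s \<Rightarrow> 's \<Rightarrow> real"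
  assumes fin: "finite S" and nonempty: "S \<noteq> {}"
    and nonneg: "x \<in> S \<Longrightarrow> y \<in> S \<Longrightarrow> 0 \<le> w x y"
    and row_sum: "x \<in> S \<Longrightarrow> (\<Sum>y\<in>S. w x y) = 1"
begin

definition P :: "('s \<Rightarrow> real) \<Rightarrow> 's \<Rightarrow> real" where
  "P f x = (\<Sum>y\<in>S. w x y * f y)"

text \<open>The integral of \<open>f\<close> against the stationary distribution, encoded as the limit of the
  iterated conditional expectations from an arbitrary state. The limit
  exists and does not depend on that state once the matrix satisfies the minorization below.\<close>
definition stat_avg :: "('s \<Rightarrow> real) \<Rightarrow> real" where
  "stat_avg f = lim (\<lambda>n. (P ^^ n) f (SOME x. x \<in> S))"

text \<open>The performance potential (bias) of the cost \<open>f\<close>.\<close>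
definition poisson :: "('s \<Rightarrow> real) \<Rightarrow> 's \<Rightarrow> real" where
  "poisson f x = (\<Sum>n. (P ^^ n) f x - stat_avg f)"

lemma P_mono: "P f x \<le> P g x" if "\<And>y. y \<in> S \<Longrightarrow> f y \<le> g y" "x \<in> S"
  unfolding P_def using that nonneg by (intro sum_mono mult_left_mono) auto

lemma P_const: "x \<in> S \<Longrightarrow> P (\<lambda>_. c) x = c"
  using row_sum by (simp add: P_def flip: sum_distrib_right)

lemma P_linear: "P (\<lambda>y. a * f y + b * g y) x = a * P f x + b * P g x"
  by (simp add: P_def sum.distrib sum_distrib_left algebra_simps)

lemma P_cong: "P f x = P g x" if "\<And>y. y \<in> S \<Longrightarrow> f y = g y"
  unfolding P_def using that by (intro sum.cong) auto

lemma Pn_mono: "(P ^^ n) f x \<le> (P ^^ n) g x" if "\<And>y. y \<in> S \<Longrightarrow> f y \<le> g y" "x \<in> S"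
  using that(2) by (induction n arbitrary: x) (use that(1) in \<open>auto intro: P_mono\<close>)

lemma Pn_const: "x \<in> S \<Longrightarrow> (P ^^ n) (\<lambda>_. c) x = c"
proof (induction n arbitrary: x)
  case (Suc n)
  then have "P ((P ^^ n) (\<lambda>_. c)) x = P (\<lambda>_. c) x" by (intro P_cong) auto
  then show ?case using P_const Suc by simp
qed simp

lemma Pn_linear: "(P ^^ n) (\<lambda>y. a * f y + b * g y) x = a * (P ^^ n) f x + b * (P ^^ n) g x"
proof (induction n arbitrary: x)
  case (Suc n)
  then have "(P ^^ n) (\<lambda>y. a * f y + b * g y) = (\<lambda>y. a * (P ^^ n) f y + b * (P ^^ n) g y)" by auto
  then show ?case by (simp add: P_linear)
qed simp

lemma Pn_Suc: "(P ^^ n) (P f) = (P ^^ Suc n) f"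
  by (metis funpow_Suc_right comp_apply)

end

text \<open>Doeblin's condition for the \<open>m\<close>-step matrix, phrased for nonnegative functions instead of matrix
  entries so that it passes to mixtures and to limits by monotonicity alone.\<close>
locale minorized_chain = stochastic_matrix S w
  for S :: "'s set" and w :: "'s \<Rightarrow> 's \<Rightarrow> real" +
  fixes m :: nat and \<epsilon> :: real
  assumes \<epsilon>_pos: "0 < \<epsilon>"
    and minor: "(\<And>y. y \<in> S \<Longrightarrow> 0 \<le> f y) \<Longrightarrow> x \<in> S \<Longrightarrow> y \<in> S \<Longrightarrow> \<epsilon> * f y \<le> (P ^^ m) f x"
begin

definition osc :: "('s \<Rightarrow> real) \<Rightarrow> real" where
  "osc f = Max (f ` S) - Min (f ` S)"

lemma osc_bound: "x \<in> S \<Longrightarrow> y \<in> S \<Longrightarrow> \<bar>f x - f y\<bar> \<le> osc f"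
proof -
  assume "x \<in> S" "y \<in> S"
  then have "f x \<le> Max (f ` S)" "f y \<le> Max (f ` S)" "Min (f ` S) \<le> f x" "Min (f ` S) \<le> f y"
    using fin by auto
  then show ?thesis by (auto simp: osc_def)
qed

lemma osc_attained: obtains x y where "x \<in> S" "y \<in> S" "osc f = f x - f y"
proof -
  have "Max (f ` S) \<in> f ` S" "Min (f ` S) \<in> f ` S" using fin nonempty by auto
  then show ?thesis using that by (auto simp: osc_def)
qed

lemma osc_nonneg: "0 \<le> osc f"
  using nonempty osc_bound[of _ _ f] by (metis abs_ge_zero ex_in_conv order_trans)

lemma Pn_within: "x \<in> S \<Longrightarrow> (P ^^ n) f x \<in> {Min (f ` S)..Max (f ` S)}"
proof -
  assume x: "x \<in> S"
  have "(P ^^ n) (\<lambda>_. Min (f ` S)) x \<le> (P ^^ n) f x" "(P ^^ n) f x \<le> (P ^^ n) (\<lambda>_. Max (f ` S)) x"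
    using fin x by (intro Pn_mono; auto)+
  then show ?thesis using x by (simp add: Pn_const)
qed

text \<open>From every state the minimum of \<open>f\<close> is hit after \<open>m\<close> steps with probability at least \<open>\<epsilon>\<close>, which
  lowers the upper bound of the average by \<open>\<epsilon> * osc f\<close>.\<close>
lemma osc_contract: "osc ((P ^^ m) f) \<le> (1 - \<epsilon>) * osc f"
proof -
  obtain x y where xy: "x \<in> S" "y \<in> S" "osc ((P ^^ m) f) = (P ^^ m) f x - (P ^^ m) f y"
    by (rule osc_attained)
  have "Min (f ` S) \<in> f ` S" using fin nonempty by auto
  then obtain z where z: "z \<in> S" "f z = Min (f ` S)" by auto
  let ?M = "Max (f ` S)"
  have "\<epsilon> * (1 * ?M + (-1) * f z) \<le> (P ^^ m) (\<lambda>y. 1 * ?M + (-1) * f y) x"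
    using fin xy z by (intro minor) auto
  also have "\<dots> = ?M - (P ^^ m) f x" using Pn_linear[of m 1 "\<lambda>_. ?M" "-1" f x] xy Pn_const by simp
  finally have "(P ^^ m) f x \<le> ?M - \<epsilon> * osc f" using z by (simp add: osc_def)
  moreover have "f z \<le> (P ^^ m) f y" using Pn_within[OF xy(2)] z by simp
  ultimately show ?thesis using xy z by (simp add: osc_def algebra_simps)
qed

lemma osc_decreasing: "osc ((P ^^ n) f) \<le> osc f"
proof -
  obtain x y where xy: "x \<in> S" "y \<in> S" "osc ((P ^^ n) f) = (P ^^ n) f x - (P ^^ n) f y"
    by (rule osc_attained)
  then show ?thesis using Pn_within[of x n f] Pn_within[of y n f] by (simp add: osc_def)
qed

text \<open>A nonnegative sequence with \<open>a (m + n) \<le> (1 - \<epsilon>) * a n\<close> that stays below \<open>a 0\<close> is summable: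
  shifting by \<open>m\<close> costs at most \<open>m * a 0\<close> and gains the factor \<open>1 - \<epsilon>\<close>, so a partial
  sum \<open>s\<close> satisfies \<open>s \<le> m * a 0 + (1 - \<epsilon>) * s\<close>.\<close>
lemma osc_summable: "summable (\<lambda>n. osc ((P ^^ n) f))"
proof -
  define a where "a = (\<lambda>n. osc ((P ^^ n) f))"
  have a0: "0 \<le> a n" "a n \<le> a 0" for n using osc_nonneg osc_decreasing by (auto simp: a_def)
  have am: "a (m + n) \<le> (1 - \<epsilon>) * a n" for n
    using osc_contract[of "(P ^^ n) f"] by (simp add: a_def funpow_add)
  have "(\<Sum>n<N. a n) \<le> m * a 0 / \<epsilon>" for N
  proof -
    have "(\<Sum>n<N. a n) \<le> (\<Sum>n<m + N. a n)" using a0 by (intro sum_mono2) auto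
    also have "\<dots> = (\<Sum>n<m. a n) + (\<Sum>n<N. a (m + n))"
    proof -
      have "(\<Sum>n<N. a (m + n)) = sum a {m..<m + N}"
        by (rule sum.reindex_bij_witness[of _ "\<lambda>n. n - m" "\<lambda>n. m + n"]) auto
      moreover have "sum a ({..<m} \<union> {m..<m + N}) = sum a {..<m} + sum a {m..<m + N}"
        by (intro sum.union_disjoint) auto
      moreover have "{..<m} \<union> {m..<m + N} = {..<m + N}" by auto
      ultimately show ?thesis by simp
    qed
    also have "\<dots> \<le> (\<Sum>n<m. a 0) + (\<Sum>n<N. (1 - \<epsilon>) * a n)"
      using a0 am by (intro add_mono sum_mono) auto
    also have "\<dots> = m * a 0 + (1 - \<epsilon>) * (\<Sum>n<N. a n)" by (simp add: sum_distrib_left)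
    finally show ?thesis using \<epsilon>_pos by (simp add: field_simps)
  qed
  then have "summable a" using a0 by (intro summableI_nonneg_bounded) auto
  then show ?thesis by (simp add: a_def)
qed

text \<open>One step moves the value by at most the current oscillation, so the increments are summable; the
  values at different states differ by the oscillation, which tends to zero.\<close>
lemma Pn_tendsto: assumes x: "x \<in> S" shows "(\<lambda>n. (P ^^ n) f x) \<longlonglongrightarrow> stat_avg f"
proof -
  define x0 where "x0 = (SOME x. x \<in> S)"
  have x0: "x0 \<in> S" unfolding x0_def using nonempty by (simp add: some_in_eq)
  have "\<bar>(P ^^ Suc n) f x0 - (P ^^ n) f x0\<bar> \<le> osc ((P ^^ n) f)" for n
    using Pn_within[OF x0, of 1 "(P ^^ n) f"] Pn_within[OF x0, of 0 "(P ^^ n) f"]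
    by (auto simp: osc_def)
  then have "summable (\<lambda>n. (P ^^ Suc n) f x0 - (P ^^ n) f x0)"
    by (intro summable_comparison_test'[OF osc_summable[of f], of 0]) auto
  then have "convergent (\<lambda>N. \<Sum>n<N. (P ^^ Suc n) f x0 - (P ^^ n) f x0)"
    by (simp only: summable_iff_convergent)
  then have "convergent (\<lambda>N. (P ^^ N) f x0 - (P ^^ 0) f x0)"
    unfolding sum_lessThan_telescope[of "\<lambda>n. (P ^^ n) f x0"] .
  then have "convergent (\<lambda>n. (P ^^ n) f x0)" by (simp only: convergent_diff_const_right_iff)
  then have lim: "(\<lambda>n. (P ^^ n) f x0) \<longlonglongrightarrow> stat_avg f"
    by (simp add: stat_avg_def convergent_LIMSEQ_iff x0_def)
  have "(\<lambda>n. (P ^^ n) f x - (P ^^ n) f x0) \<longlonglongrightarrow> 0"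
    by (rule Lim_null_comparison[OF _ summable_LIMSEQ_zero[OF osc_summable[of f]]])
       (use osc_bound x x0 in auto)
  from tendsto_add[OF this lim] show ?thesis by simp
qed

lemma stat_avg_linear: "stat_avg (\<lambda>y. a * f y + b * g y) = a * stat_avg f + b * stat_avg g"
proof -
  obtain x where x: "x \<in> S" using nonempty by auto
  have "(\<lambda>n. a * (P ^^ n) f x + b * (P ^^ n) g x) \<longlonglongrightarrow> a * stat_avg f + b * stat_avg g"
    using x by (intro tendsto_intros Pn_tendsto)
  then have "(\<lambda>n. (P ^^ n) (\<lambda>y. a * f y + b * g y) x) \<longlonglongrightarrow> a * stat_avg f + b * stat_avg g"
    by (simp add: Pn_linear)
  then show ?thesis using LIMSEQ_unique[OF Pn_tendsto[OF x]] by blast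
qed

lemma stat_avg_mono: "(\<And>y. y \<in> S \<Longrightarrow> f y \<le> g y) \<Longrightarrow> stat_avg f \<le> stat_avg g"
proof -
  assume le: "\<And>y. y \<in> S \<Longrightarrow> f y \<le> g y"
  obtain x where x: "x \<in> S" using nonempty by auto
  show ?thesis by (rule LIMSEQ_le[OF Pn_tendsto[OF x] Pn_tendsto[OF x]]) (use Pn_mono le x in blast)
qed

lemma stat_avg_cong: "(\<And>y. y \<in> S \<Longrightarrow> f y = g y) \<Longrightarrow> stat_avg f = stat_avg g"
  by (intro antisym stat_avg_mono) auto

lemma stat_avg_const: "stat_avg (\<lambda>_. c) = c"
proof -
  obtain x where x: "x \<in> S" using nonempty by auto
  show ?thesis using Pn_tendsto[OF x, of "\<lambda>_. c"] Pn_const[OF x] LIMSEQ_unique tendsto_const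
    by (simp add: LIMSEQ_const_iff)
qed

lemma stat_avg_P: "stat_avg (P f) = stat_avg f"
proof -
  obtain x where x: "x \<in> S" using nonempty by auto
  have "(\<lambda>n. (P ^^ n) (P f) x) \<longlonglongrightarrow> stat_avg f"
    unfolding Pn_Suc using Pn_tendsto[OF x] by (rule LIMSEQ_Suc)
  then show ?thesis using LIMSEQ_unique Pn_tendsto[OF x] by blast
qed

text \<open>Every state carries stationary mass at least \<open>\<epsilon>\<close>.\<close>
lemma stat_avg_lower:
  assumes "\<And>y. y \<in> S \<Longrightarrow> 0 \<le> f y" "y \<in> S" shows "\<epsilon> * f y \<le> stat_avg f"
proof -
  have "stat_avg ((P ^^ m) f) = stat_avg f"
  proof -
    obtain x where x: "x \<in> S" using nonempty by auto
    have "(\<lambda>n. (P ^^ n) ((P ^^ m) f) x) \<longlonglongrightarrow> stat_avg f"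
      using LIMSEQ_ignore_initial_segment[OF Pn_tendsto[OF x, of f], of m] by (simp add: funpow_add)
    then show ?thesis using LIMSEQ_unique Pn_tendsto[OF x] by blast
  qed
  moreover have "stat_avg (\<lambda>_. \<epsilon> * f y) \<le> stat_avg ((P ^^ m) f)"
    using minor assms by (intro stat_avg_mono) auto
  ultimately show ?thesis by (simp add: stat_avg_const)
qed

lemma poisson_summable: assumes x: "x \<in> S" shows "summable (\<lambda>n. (P ^^ n) f x - stat_avg f)"
proof -
  have "\<bar>(P ^^ n) f x - stat_avg f\<bar> \<le> osc ((P ^^ n) f)" for n
  proof -
    let ?g = "(P ^^ n) f"
    have "(\<lambda>k. (P ^^ (k + n)) f x) \<longlonglongrightarrow> stat_avg f"
      using LIMSEQ_ignore_initial_segment[OF Pn_tendsto[OF x, of f], of n] .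
    then have lim: "(\<lambda>k. (P ^^ k) ?g x) \<longlonglongrightarrow> stat_avg f" by (simp add: funpow_add)
    have "stat_avg f \<in> {Min (?g ` S)..Max (?g ` S)}"
      using Pn_within[OF x, of _ ?g] closed_sequentially[OF closed_atLeastAtMost _ lim] by blast
    then show ?thesis using Pn_within[OF x, of 0 ?g] by (auto simp: osc_def)
  qed
  then show ?thesis by (intro summable_comparison_test'[OF osc_summable[of f], of 0]) auto
qed

text \<open>Applying \<open>P\<close> shifts the defining series by one term.\<close>
lemma poisson_equation:
  assumes x: "x \<in> S" shows "poisson f x + stat_avg f = f x + P (poisson f) x"
proof -
  let ?d = "\<lambda>n y. (P ^^ n) f y - stat_avg f"
  have "P (poisson f) x = (\<Sum>y\<in>S. \<Sum>n. w x y * ?d n y)"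
    unfolding poisson_def by (subst P_def) (intro sum.cong refl suminf_mult[symmetric] poisson_summable)
  also have "\<dots> = (\<Sum>n. \<Sum>y\<in>S. w x y * ?d n y)"
    by (intro suminf_sum[symmetric] summable_mult poisson_summable)
  also have "(\<lambda>n. \<Sum>y\<in>S. w x y * ?d n y) = (\<lambda>n. ?d (Suc n) x)"
    using row_sum[OF x]
    by (auto simp: P_def right_diff_distrib sum_subtractf simp flip: sum_distrib_right)
  also have "(\<Sum>n. ?d (Suc n) x) = poisson f x - ?d 0 x"
    unfolding poisson_def by (rule suminf_split_head[OF poisson_summable[OF x]])
  finally show ?thesis by simp
qed

end

section \<open>Markov property and law of large numbers on path space\<close>

lemma path_component_measurable [measurable]:
  "(\<lambda>\<omega>. \<omega> t) \<in> path_law \<nu> K \<rightarrow>\<^sub>M count_space UNIV"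
  unfolding measurable_cong_sets[OF sets_path_law refl] by (rule measurable_component_singleton) auto

lemma path_function_measurable:
  assumes "space M = UNIV"
  shows "(\<lambda>\<omega>. g (\<omega> t)) \<in> path_law \<nu> K \<rightarrow>\<^sub>M M"
  by (rule measurable_compose[OF path_component_measurable]) (simp add: assms)

lemma space_path_law [simp]: "space (path_law \<nu> K) = UNIV"
  by (simp add: sets_eq_imp_space_eq[OF sets_path_law] space_PiM)

definition cylinder :: "nat \<Rightarrow> (nat \<Rightarrow> 'x) \<Rightarrow> (nat \<Rightarrow> 'x) set" where
  "cylinder T x = {\<omega>. \<forall>t\<le>T. \<omega> t = x t}"

lemma cylinder_sets [measurable]: "cylinder T x \<in> sets (path_law \<nu> K)"
proof -
  have "{\<omega> \<in> space (path_law \<nu> K). \<forall>t\<in>{..T}. \<omega> t = x t} \<in> sets (path_law \<nu> K)"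
    by measurable
  then show ?thesis by (simp add: cylinder_def Ball_def)
qed

lemma measure_cylinder:
  "measure (path_law \<nu> K) (cylinder T x) = pmf \<nu> (x 0) * (\<Prod>t<T. pmf (K (x t)) (x (Suc t)))"
  unfolding cylinder_def measure_def emeasure_path_law_cylinder
  by (intro enn2real_ennreal mult_nonneg_nonneg prod_nonneg) auto

text \<open>The Markov property in its elementary form, from which all expectations below are computed.\<close>
lemma measure_cylinder_Suc:
  "measure (path_law \<nu> K) (cylinder (Suc T) (x(Suc T := y)))
    = measure (path_law \<nu> K) (cylinder T x) * pmf (K (x T)) y"
proof -
  have "(\<Prod>t<T. pmf (K ((x(Suc T := y)) t)) ((x(Suc T := y)) (Suc t)))
      = (\<Prod>t<T. pmf (K (x t)) (x (Suc t)))"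
    by (intro prod.cong) auto
  then show ?thesis by (simp add: measure_cylinder)
qed

locale finite_chain =
  fixes S :: "'x set" and \<nu> :: "'x pmf" and K :: "'x \<Rightarrow> 'x pmf"
  assumes finite_S: "finite S" and init: "set_pmf \<nu> \<subseteq> S"
    and closed: "x \<in> S \<Longrightarrow> set_pmf (K x) \<subseteq> S"
begin

abbreviation "\<P> \<equiv> path_law \<nu> K"

sublocale prob_space \<P> by (rule prob_space_path_law)

text \<open>The path law lives on sequences over the whole type, and a function may be unbounded off \<open>S\<close>.
  Restricting to the trajectories that stay in \<open>S\<close> up to time \<open>T\<close> reduces every expectation
  to a finite sum over cylinders; that this event has probability one is itself derived from the
  restricted identities.\<close>
definition stays :: "nat \<Rightarrow> (nat \<Rightarrow> 'x) set" where
  "stays T = {\<omega>. \<forall>t\<le>T. \<omega> t \<in> S}"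

definition step :: "('x \<Rightarrow> real) \<Rightarrow> 'x \<Rightarrow> real" where
  "step g x = measure_pmf.expectation (K x) g"

lemma step_eq_sum: "x \<in> S \<Longrightarrow> step g x = (\<Sum>y\<in>S. g y * pmf (K x) y)"
  unfolding step_def using finite_S closed by (intro integral_measure_pmf_real) auto

lemma stays_sets [measurable]: "stays T \<in> sets \<P>"
proof -
  note [measurable] = path_function_measurable[of "count_space UNIV" "\<lambda>x. x \<in> S", simplified]
  have "{\<omega> \<in> space \<P>. \<forall>t\<in>{..T}. \<omega> t \<in> S} \<in> sets \<P>" by measurable
  then show ?thesis by (simp add: stays_def Ball_def)
qed

lemma path_decomposition:
  assumes F: "\<And>\<omega> \<omega>'. (\<And>t. t \<le> T \<Longrightarrow> \<omega> t = \<omega>' t) \<Longrightarrow> F \<omega> = F \<omega>'"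
  shows "F \<omega> * indicator (stays T) \<omega>
    = (\<Sum>x\<in>{..T} \<rightarrow>\<^sub>E S. F x * indicator (cylinder T x) \<omega> :: real)"
proof (cases "\<omega> \<in> stays T")
  case True
  define x0 where "x0 = restrict \<omega> {..T}"
  have x0: "x0 \<in> {..T} \<rightarrow>\<^sub>E S" using True by (auto simp: x0_def stays_def)
  have "indicator (cylinder T x) \<omega> = (if x = x0 then 1 else 0 :: real)" if "x \<in> {..T} \<rightarrow>\<^sub>E S" for x
  proof -
    have "x = x0 \<longleftrightarrow> (\<forall>t\<le>T. \<omega> t = x t)"
    proof
      assume "\<forall>t\<le>T. \<omega> t = x t"
      then show "x = x0" using x0 that by (intro PiE_ext[OF that x0]) (auto simp: x0_def)
    qed (auto simp: x0_def)
    then show ?thesis by (auto simp: cylinder_def indicator_def)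
  qed
  then have "(\<Sum>x\<in>{..T} \<rightarrow>\<^sub>E S. F x * indicator (cylinder T x) \<omega> :: real)
      = (\<Sum>x\<in>{..T} \<rightarrow>\<^sub>E S. if x = x0 then F x else 0)"
    by (intro sum.cong) auto
  also have "\<dots> = F x0" using x0 finite_S by (simp add: finite_PiE)
  also have "\<dots> = F \<omega>" by (rule F) (simp add: x0_def)
  finally show ?thesis using True by simp
next
  case False
  have "indicator (cylinder T x) \<omega> = (0 :: real)" if "x \<in> {..T} \<rightarrow>\<^sub>E S" for x
    using False that by (force simp: cylinder_def stays_def indicator_def)
  then show ?thesis using False by simp
qed

lemma integral_cylinder_sum:
  fixes F :: "(nat \<Rightarrow> 'x) \<Rightarrow> real"
  assumes "\<And>\<omega>. F \<omega> = (\<Sum>p\<in>X. f p * indicator (cylinder T (q p)) \<omega>)"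
  shows "(\<integral>\<omega>. F \<omega> \<partial>\<P>) = (\<Sum>p\<in>X. f p * measure \<P> (cylinder T (q p)))"
  unfolding assms by (subst Bochner_Integration.integral_sum) (auto simp: emeasure_eq_measure)

text \<open>Both sides are finite sums over the trajectories in \<open>S\<close>, and summing out the last coordinate of
  the left one gives the right one. Only indicators of cylinders are integrated, so \<open>F\<close> may be any
  function of the past.\<close>
lemma one_step_restricted:
  fixes F :: "(nat \<Rightarrow> 'x) \<Rightarrow> real"
  assumes F: "\<And>\<omega> \<omega>'. (\<And>t. t \<le> T \<Longrightarrow> \<omega> t = \<omega>' t) \<Longrightarrow> F \<omega> = F \<omega>'"
  shows "(\<integral>\<omega>. F \<omega> * g (\<omega> (Suc T)) * indicator (stays (Suc T)) \<omega> \<partial>\<P>)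
    = (\<integral>\<omega>. F \<omega> * step g (\<omega> T) * indicator (stays T) \<omega> \<partial>\<P>)"
proof -
  let ?W = "{..T} \<rightarrow>\<^sub>E S"
  have finW: "finite ?W" using finite_S by (simp add: finite_PiE)
  have last: "(\<Sum>y\<in>S. g y * indicator {y} z) = g z * indicator S z" for z
    using finite_S by (auto simp: indicator_def if_distrib cong: if_cong)
  have "F \<omega> * g (\<omega> (Suc T)) * indicator (stays (Suc T)) \<omega>
      = (\<Sum>p\<in>?W \<times> S. (F (fst p) * g (snd p)) * indicator (cylinder (Suc T) ((fst p)(Suc T := snd p))) \<omega>)" for \<omega>
  proof -
    have "F \<omega> * g (\<omega> (Suc T)) * indicator (stays (Suc T)) \<omega>
        = (F \<omega> * indicator (stays T) \<omega>) * (g (\<omega> (Suc T)) * indicator S (\<omega> (Suc T)))"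
      by (auto simp: stays_def indicator_def le_Suc_eq)
    also have "\<dots> = (\<Sum>x\<in>?W. \<Sum>y\<in>S. (F x * indicator (cylinder T x) \<omega>) * (g y * indicator {y} (\<omega> (Suc T))))"
      by (simp only: path_decomposition[of T F, OF F] last[symmetric] sum_product)
    also have "\<dots> = (\<Sum>x\<in>?W. \<Sum>y\<in>S. F x * g y * indicator (cylinder (Suc T) (x(Suc T := y))) \<omega>)"
      by (intro sum.cong refl) (auto simp: cylinder_def indicator_def le_Suc_eq)
    finally show ?thesis by (simp only: sum.cartesian_product case_prod_unfold)
  qed
  then have "(\<integral>\<omega>. F \<omega> * g (\<omega> (Suc T)) * indicator (stays (Suc T)) \<omega> \<partial>\<P>)
      = (\<Sum>p\<in>?W \<times> S. (F (fst p) * g (snd p)) * measure \<P> (cylinder (Suc T) ((fst p)(Suc T := snd p))))"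
    by (rule integral_cylinder_sum)
  also have "\<dots> = (\<Sum>x\<in>?W. \<Sum>y\<in>S. F x * g y * (measure \<P> (cylinder T x) * pmf (K (x T)) y))"
    by (simp only: sum.cartesian_product case_prod_unfold measure_cylinder_Suc)
  also have "\<dots> = (\<Sum>x\<in>?W. F x * step g (x T) * measure \<P> (cylinder T x))"
  proof (intro sum.cong refl)
    fix x assume "x \<in> ?W"
    then have "x T \<in> S" by auto
    then show "(\<Sum>y\<in>S. F x * g y * (measure \<P> (cylinder T x) * pmf (K (x T)) y))
        = F x * step g (x T) * measure \<P> (cylinder T x)"
      by (simp add: step_eq_sum sum_distrib_left sum_distrib_right mult_ac)
  qed
  also have "\<dots> = (\<integral>\<omega>. F \<omega> * step g (\<omega> T) * indicator (stays T) \<omega> \<partial>\<P>)"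
  proof -
    have "F \<omega> * step g (\<omega> T) * indicator (stays T) \<omega>
        = (\<Sum>x\<in>?W. (F x * step g (x T)) * indicator (cylinder T x) \<omega>)" for \<omega>
      by (rule path_decomposition[of T "\<lambda>\<omega>. F \<omega> * step g (\<omega> T)"]) (metis F order_refl)
    then show ?thesis by (rule integral_cylinder_sum[symmetric])
  qed
  finally show ?thesis .
qed

lemma measure_stays: "measure \<P> (stays T) = 1"
proof (induction T)
  case 0
  have "indicator (stays 0) \<omega> = (\<Sum>y\<in>S. 1 * indicator (cylinder 0 (\<lambda>_. y)) \<omega> :: real)" for \<omega> :: "nat \<Rightarrow> 'x"
    using finite_S by (auto simp: stays_def cylinder_def indicator_def)
  then have "(\<integral>\<omega>. indicator (stays 0) \<omega> \<partial>\<P>) = (\<Sum>y\<in>S. 1 * measure \<P> (cylinder 0 (\<lambda>_. y)))"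
    by (rule integral_cylinder_sum)
  then have "measure \<P> (stays 0) = (\<Sum>y\<in>S. pmf \<nu> y)"
    by (simp add: measure_cylinder)
  also have "\<dots> = 1" using finite_S init by (rule sum_pmf_eq_1)
  finally show ?case .
next
  case (Suc T)
  have "(\<integral>\<omega>. 1 * 1 * indicator (stays (Suc T)) \<omega> \<partial>\<P>)
      = (\<integral>\<omega>. 1 * step (\<lambda>_. 1) (\<omega> T) * indicator (stays T) \<omega> \<partial>\<P>)"
    by (rule one_step_restricted[of T "\<lambda>_. 1" "\<lambda>_. 1"]) simp
  then show ?case using Suc by (simp add: step_def)
qed

lemma AE_in_S: "AE \<omega> in \<P>. \<forall>t. \<omega> t \<in> S"
proof (subst AE_all_countable, intro allI)
  fix t
  have "AE \<omega> in \<P>. \<omega> \<in> stays t" using measure_stays by (subst AE_in_set_eq_1) auto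
  then show "AE \<omega> in \<P>. \<omega> t \<in> S" by eventually_elim (auto simp: stays_def)
qed

lemma integrable_bounded_on_S:
  fixes F :: "(nat \<Rightarrow> 'x) \<Rightarrow> real"
  assumes [measurable]: "F \<in> borel_measurable \<P>"
    and bound: "\<And>\<omega>. (\<And>t. \<omega> t \<in> S) \<Longrightarrow> \<bar>F \<omega>\<bar> \<le> B"
  shows "integrable \<P> F"
proof (rule integrable_const_bound)
  show "AE \<omega> in \<P>. norm (F \<omega>) \<le> B"
    using AE_in_S by eventually_elim (simp add: bound)
qed measurable

theorem markov_property:
  fixes F :: "(nat \<Rightarrow> 'x) \<Rightarrow> real"
  assumes "F \<in> borel_measurable \<P>"
    and F: "\<And>\<omega> \<omega>'. (\<And>t. t \<le> T \<Longrightarrow> \<omega> t = \<omega>' t) \<Longrightarrow> F \<omega> = F \<omega>'"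
  shows "(\<integral>\<omega>. F \<omega> * g (\<omega> (Suc T)) \<partial>\<P>) = (\<integral>\<omega>. F \<omega> * step g (\<omega> T) \<partial>\<P>)"
proof -
  note meas = borel_measurable_times borel_measurable_indicator stays_sets assms(1)
    path_function_measurable[OF space_borel]
  have stay: "AE \<omega> in \<P>. \<omega> \<in> stays T \<and> \<omega> \<in> stays (Suc T)"
    using AE_in_S by eventually_elim (simp add: stays_def)
  have "(\<integral>\<omega>. F \<omega> * g (\<omega> (Suc T)) \<partial>\<P>)
      = (\<integral>\<omega>. F \<omega> * g (\<omega> (Suc T)) * indicator (stays (Suc T)) \<omega> \<partial>\<P>)"
    by (intro integral_cong_AE meas) (rule eventually_mono[OF stay], simp)
  also have "\<dots> = (\<integral>\<omega>. F \<omega> * step g (\<omega> T) * indicator (stays T) \<omega> \<partial>\<P>)"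
    by (rule one_step_restricted[OF F])
  also have "\<dots> = (\<integral>\<omega>. F \<omega> * step g (\<omega> T) \<partial>\<P>)"
    by (intro integral_cong_AE meas) (rule eventually_mono[OF stay], simp)
  finally show ?thesis .
qed

end

context finite_chain
begin

definition martingale :: "('x \<Rightarrow> real) \<Rightarrow> nat \<Rightarrow> (nat \<Rightarrow> 'x) \<Rightarrow> real" where
  "martingale h T \<omega> = (\<Sum>t<T. h (\<omega> (Suc t)) - step h (\<omega> t))"

lemma martingale_measurable: "martingale h T \<in> borel_measurable \<P>"
  unfolding martingale_def[abs_def]
  by (rule borel_measurable_sum[OF borel_measurable_diff])
    (rule path_function_measurable[OF space_borel])+

lemma step_bound:
  assumes "\<And>y. y \<in> S \<Longrightarrow> \<bar>h y\<bar> \<le> B" "x \<in> S" shows "\<bar>step h x\<bar> \<le> B"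
proof -
  have "\<bar>step h x\<bar> \<le> (\<Sum>y\<in>S. B * pmf (K x) y)"
    unfolding step_eq_sum[OF \<open>x \<in> S\<close>]
    by (rule order_trans[OF sum_abs sum_mono]) (auto simp: abs_mult assms mult_right_mono)
  also have "\<dots> = B"
    using sum_pmf_eq_1[OF finite_S closed[OF \<open>x \<in> S\<close>]] by (simp flip: sum_distrib_left)
  finally show ?thesis .
qed

lemma martingale_increment_bound:
  assumes "\<And>y. y \<in> S \<Longrightarrow> \<bar>h y\<bar> \<le> B" "\<And>t. \<omega> t \<in> S" "T \<le> T'"
  shows "\<bar>martingale h T' \<omega> - martingale h T \<omega>\<bar> \<le> 2 * B * real (T' - T)"
proof -
  have "martingale h T' \<omega> = martingale h T \<omega> + (\<Sum>t\<in>{T..<T'}. h (\<omega> (Suc t)) - step h (\<omega> t))"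
    unfolding martingale_def using assms(3)
    by (subst sum.union_disjoint[symmetric]) (auto intro!: sum.cong)
  then have "\<bar>martingale h T' \<omega> - martingale h T \<omega>\<bar>
      \<le> (\<Sum>t\<in>{T..<T'}. \<bar>h (\<omega> (Suc t)) - step h (\<omega> t)\<bar>)"
    by (simp add: sum_abs)
  also have "\<dots> \<le> (\<Sum>t\<in>{T..<T'}. 2 * B)"
  proof (rule sum_mono)
    fix t
    have "\<bar>h (\<omega> (Suc t))\<bar> \<le> B" "\<bar>step h (\<omega> t)\<bar> \<le> B" using step_bound assms by auto
    then show "\<bar>h (\<omega> (Suc t)) - step h (\<omega> t)\<bar> \<le> 2 * B" by linarith
  qed
  finally show ?thesis by (simp add: mult.commute)
qed

lemma martingale_bound:
  assumes "\<And>y. y \<in> S \<Longrightarrow> \<bar>h y\<bar> \<le> B" "\<And>t. \<omega> t \<in> S"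
  shows "\<bar>martingale h T \<omega>\<bar> \<le> 2 * B * real T"
  using martingale_increment_bound[OF assms, where T = 0 and T' = T] by (simp add: martingale_def)

text \<open>By the Markov property the next prediction error is orthogonal to all functions of the past, so the
  second moment grows by at most \<open>(2 * B)\<^sup>2\<close> per step.\<close>
lemma martingale_second_moment:
  assumes B: "\<And>y. y \<in> S \<Longrightarrow> \<bar>h y\<bar> \<le> B"
  shows "integrable \<P> (\<lambda>\<omega>. (martingale h T \<omega>)\<^sup>2)"
    and "(\<integral>\<omega>. (martingale h T \<omega>)\<^sup>2 \<partial>\<P>) \<le> (2 * B)\<^sup>2 * real T"
proof -
  note meas = borel_measurable_times borel_measurable_power borel_measurable_diff
    martingale_measurable path_function_measurable[OF space_borel]
  have sq: "integrable \<P> (\<lambda>\<omega>. (martingale h T \<omega>)\<^sup>2)" for T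
  proof (rule integrable_bounded_on_S)
    show "\<bar>(martingale h T \<omega>)\<^sup>2\<bar> \<le> (2 * B * real T)\<^sup>2" if "\<And>t. \<omega> t \<in> S" for \<omega>
      using martingale_bound[where h = h and \<omega> = \<omega> and T = T, OF B that] by (simp add: abs_le_square_iff[symmetric] order_trans[OF _ abs_ge_self])
  qed (intro meas)
  then show "integrable \<P> (\<lambda>\<omega>. (martingale h T \<omega>)\<^sup>2)" .
  show "(\<integral>\<omega>. (martingale h T \<omega>)\<^sup>2 \<partial>\<P>) \<le> (2 * B)\<^sup>2 * real T"
  proof (induction T)
    case 0
    then show ?case by (simp add: martingale_def)
  next
    case (Suc T)
    define D where "D = (\<lambda>\<omega>. h (\<omega> (Suc T)) - step h (\<omega> T))"
    have Suc_eq: "martingale h (Suc T) \<omega> = martingale h T \<omega> + D \<omega>" for \<omega>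
      by (simp add: martingale_def D_def)
    have D_meas: "D \<in> borel_measurable \<P>" unfolding D_def by (intro meas)
    have D_bound: "\<bar>D \<omega>\<bar> \<le> 2 * B" if "\<And>t. \<omega> t \<in> S" for \<omega>
      using martingale_increment_bound[where h = h and \<omega> = \<omega> and T = T and T' = "Suc T", OF B that] by (simp add: Suc_eq)
    have prod_int: "integrable \<P> (\<lambda>\<omega>. martingale h T \<omega> * g (\<omega> t))"
      if g: "\<And>x. x \<in> S \<Longrightarrow> \<bar>g x\<bar> \<le> B" for g t
    proof (rule integrable_bounded_on_S)
      show "\<bar>martingale h T \<omega> * g (\<omega> t)\<bar> \<le> 2 * B * real T * B" if "\<And>t. \<omega> t \<in> S" for \<omega>
        unfolding abs_mult using martingale_bound[where h = h and \<omega> = \<omega> and T = T, OF B that] g[OF that, of t]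
        by (intro mult_mono) auto
    qed (intro meas)
    have int1: "integrable \<P> (\<lambda>\<omega>. martingale h T \<omega> * h (\<omega> (Suc T)))"
      and int2: "integrable \<P> (\<lambda>\<omega>. martingale h T \<omega> * step h (\<omega> T))"
      by (rule prod_int, use B step_bound in blast)+
    have D2: "integrable \<P> (\<lambda>\<omega>. (D \<omega>)\<^sup>2)" "(\<integral>\<omega>. (D \<omega>)\<^sup>2 \<partial>\<P>) \<le> (2 * B)\<^sup>2"
    proof -
      have le: "(D \<omega>)\<^sup>2 \<le> (2 * B)\<^sup>2" if "\<And>t. \<omega> t \<in> S" for \<omega>
        using power_mono[OF D_bound[of \<omega>, OF that], of 2] by simp
      show int: "integrable \<P> (\<lambda>\<omega>. (D \<omega>)\<^sup>2)"
      proof (rule integrable_bounded_on_S)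
        show "\<bar>(D \<omega>)\<^sup>2\<bar> \<le> (2 * B)\<^sup>2" if "\<And>t. \<omega> t \<in> S" for \<omega>
          using le[of \<omega>, OF that] by simp
      qed (intro borel_measurable_power D_meas)
      have "AE \<omega> in \<P>. (D \<omega>)\<^sup>2 \<le> (2 * B)\<^sup>2" using AE_in_S by eventually_elim (rule le, simp)
      then show "(\<integral>\<omega>. (D \<omega>)\<^sup>2 \<partial>\<P>) \<le> (2 * B)\<^sup>2" by (rule integral_le_const[OF int])
    qed
    have "(\<integral>\<omega>. martingale h T \<omega> * h (\<omega> (Suc T)) \<partial>\<P>)
        = (\<integral>\<omega>. martingale h T \<omega> * step h (\<omega> T) \<partial>\<P>)"
      by (rule markov_property[OF martingale_measurable]) (simp add: martingale_def)
    then have orth: "(\<integral>\<omega>. martingale h T \<omega> * D \<omega> \<partial>\<P>) = 0"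
      using int1 int2 by (simp add: D_def right_diff_distrib)
    have int3: "integrable \<P> (\<lambda>\<omega>. martingale h T \<omega> * D \<omega>)"
      using int1 int2 by (simp add: D_def right_diff_distrib)
    have "(\<integral>\<omega>. (martingale h (Suc T) \<omega>)\<^sup>2 \<partial>\<P>)
        = (\<integral>\<omega>. (martingale h T \<omega>)\<^sup>2 + 2 * (martingale h T \<omega> * D \<omega>) + (D \<omega>)\<^sup>2 \<partial>\<P>)"
      by (simp add: Suc_eq power2_sum algebra_simps)
    also have "\<dots> = (\<integral>\<omega>. (martingale h T \<omega>)\<^sup>2 \<partial>\<P>) + (\<integral>\<omega>. (D \<omega>)\<^sup>2 \<partial>\<P>)"
      using sq[of T] D2(1) int3 orth by simp
    finally show ?case using Suc D2(2) by (simp add: algebra_simps)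
  qed
qed

lemma floor_sqrt_filterlim: "filterlim floor_sqrt at_top sequentially"
proof (unfold filterlim_at_top eventually_sequentially, intro allI exI impI)
  show "Z \<le> floor_sqrt n" if "Z\<^sup>2 \<le> n" for Z n
    using that by (rule le_floor_sqrtI)
qed

text \<open>The second moment of the average at time \<open>T\<close> is of order \<open>1 / T\<close>. This is summable along the squares
  \<open>T = k\<^sup>2\<close>, which gives almost sure convergence there. Between two consecutive squares
  the martingale moves by at most a multiple of \<open>k\<close>, which is negligible against \<open>k\<^sup>2\<close>.\<close>
lemma martingale_law_of_large_numbers:
  "AE \<omega> in \<P>. (\<lambda>T. martingale h T \<omega> / real T) \<longlonglongrightarrow> 0"
proof -
  define B where "B = (\<Sum>y\<in>S. \<bar>h y\<bar>)"
  have B: "\<bar>h y\<bar> \<le> B" if "y \<in> S" for y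
    unfolding B_def using finite_S that by (intro member_le_sum[where f = "\<lambda>y. \<bar>h y\<bar>"]) auto
  define X where "X = (\<lambda>k \<omega>. martingale h (k\<^sup>2) \<omega> / real (k\<^sup>2))"
  define a where "a = (\<lambda>k. (2 * B)\<^sup>2 * inverse (real k ^ 2))"
  have X_meas: "X k \<in> borel_measurable \<P>" for k
    unfolding X_def by (intro borel_measurable_divide martingale_measurable borel_measurable_const)
  have X2: "(\<integral>\<^sup>+\<omega>. ennreal ((X k \<omega>)\<^sup>2) \<partial>\<P>) \<le> ennreal (a k)" for k
  proof -
    have "integrable \<P> (\<lambda>\<omega>. (martingale h (k\<^sup>2) \<omega>)\<^sup>2 / (real (k\<^sup>2))\<^sup>2)"
      by (intro integrable_divide_zero martingale_second_moment(1)[OF B])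
    then have int: "integrable \<P> (\<lambda>\<omega>. (X k \<omega>)\<^sup>2)" by (simp add: X_def power_divide)
    have "(\<integral>\<omega>. (X k \<omega>)\<^sup>2 \<partial>\<P>) = (\<integral>\<omega>. (martingale h (k\<^sup>2) \<omega>)\<^sup>2 \<partial>\<P>) / (real (k\<^sup>2))\<^sup>2"
      by (simp add: X_def power_divide)
    also have "\<dots> \<le> ((2 * B)\<^sup>2 * real (k\<^sup>2)) / (real (k\<^sup>2))\<^sup>2"
      by (intro divide_right_mono martingale_second_moment(2)[OF B]) auto
    also have "\<dots> = a k" by (simp add: a_def field_simps power2_eq_square)
    finally show ?thesis using int by (subst nn_integral_eq_integral) (auto intro: ennreal_leI)
  qed
  have "summable a" unfolding a_def by (intro summable_mult inverse_power_summable) auto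
  have "(\<integral>\<^sup>+\<omega>. (\<Sum>k. ennreal ((X k \<omega>)\<^sup>2)) \<partial>\<P>) = (\<Sum>k. \<integral>\<^sup>+\<omega>. ennreal ((X k \<omega>)\<^sup>2) \<partial>\<P>)"
    using X_meas by (intro nn_integral_suminf) measurable
  also have "\<dots> \<le> (\<Sum>k. ennreal (a k))" by (intro suminf_le X2) auto
  also have "\<dots> = ennreal (\<Sum>k. a k)"
    using \<open>summable a\<close> by (intro suminf_ennreal2) (auto simp: a_def)
  finally have "(\<integral>\<^sup>+\<omega>. (\<Sum>k. ennreal ((X k \<omega>)\<^sup>2)) \<partial>\<P>) \<noteq> \<infinity>"
    by (auto simp: top_unique)
  then have "AE \<omega> in \<P>. (\<Sum>k. ennreal ((X k \<omega>)\<^sup>2)) \<noteq> \<infinity>"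
    using X_meas by (intro nn_integral_PInf_AE) measurable
  then show ?thesis using AE_in_S
  proof eventually_elim
    case (elim \<omega>)
    have "summable (\<lambda>k. (X k \<omega>)\<^sup>2)"
      using elim(1) by (intro summable_suminf_not_top) auto
    then have "(\<lambda>k. (X k \<omega>)\<^sup>2) \<longlonglongrightarrow> 0" by (rule summable_LIMSEQ_zero)
    then have X0: "(\<lambda>k. X k \<omega>) \<longlonglongrightarrow> 0" by (simp only: power_tendsto_0_iff zero_less_numeral)
    have "(\<lambda>k. \<bar>X k \<omega>\<bar> + 4 * B / real k) \<longlonglongrightarrow> \<bar>0\<bar> + 0"
      by (intro tendsto_add tendsto_rabs X0 lim_const_over_n)
    then have lim: "(\<lambda>T. \<bar>X (floor_sqrt T) \<omega>\<bar> + 4 * B / real (floor_sqrt T)) \<longlonglongrightarrow> 0"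
      using filterlim_compose[OF _ floor_sqrt_filterlim] by force
    have "\<bar>martingale h T \<omega> / real T\<bar> \<le> \<bar>X (floor_sqrt T) \<omega>\<bar> + 4 * B / real (floor_sqrt T)"
      if "T \<ge> 1" for T
    proof -
      define k where "k = floor_sqrt T"
      have k: "k \<ge> 1" "k\<^sup>2 \<le> T" "T - k\<^sup>2 \<le> 2 * k"
        using le_floor_sqrtI[of 1 T] that floor_sqrt_power2_le[of T] Suc_floor_sqrt_power2_gt[of T]
        by (auto simp: k_def power2_eq_square)
      have "0 \<le> B" by (simp add: B_def sum_nonneg)
      have "\<bar>martingale h T \<omega>\<bar> \<le> \<bar>martingale h (k\<^sup>2) \<omega>\<bar> + 2 * B * real (T - k\<^sup>2)"
        using martingale_increment_bound[where h = h and \<omega> = \<omega>, OF B _ k(2)] elim by auto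
      also have "\<dots> \<le> \<bar>martingale h (k\<^sup>2) \<omega>\<bar> + 2 * B * (2 * real k)"
        using k(3) \<open>0 \<le> B\<close> by (intro add_left_mono mult_left_mono) linarith+
      finally have "\<bar>martingale h T \<omega> / real T\<bar>
          \<le> (\<bar>martingale h (k\<^sup>2) \<omega>\<bar> + 4 * B * real k) / real T"
        by (simp add: divide_right_mono)
      also have "\<dots> \<le> (\<bar>martingale h (k\<^sup>2) \<omega>\<bar> + 4 * B * real k) / real (k\<^sup>2)"
        using k \<open>0 \<le> B\<close> that by (intro divide_left_mono mult_pos_pos) (auto intro: of_nat_mono)
      also have "\<dots> = \<bar>X k \<omega>\<bar> + 4 * B / real k"
        using k(1) by (simp add: X_def field_simps power2_eq_square)
      finally show ?thesis by (simp add: k_def)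
    qed
    then have "eventually (\<lambda>T. norm (martingale h T \<omega> / real T)
        \<le> \<bar>X (floor_sqrt T) \<omega>\<bar> + 4 * B / real (floor_sqrt T)) sequentially"
      unfolding eventually_sequentially real_norm_def by blast
    then show ?case by (rule Lim_null_comparison[OF _ lim])
  qed
qed

text \<open>Any solution of the Poisson equation for \<open>f\<close> will do: it makes \<open>f - c\<close> the sum of a prediction
  error and a telescoping term.\<close>
theorem strong_law:
  assumes poisson: "\<And>x. x \<in> S \<Longrightarrow> h x + c = f x + step h x"
  shows "AE \<omega> in \<P>. (\<lambda>T. (\<Sum>t<T. f (\<omega> t)) / real T) \<longlonglongrightarrow> c"
  using martingale_law_of_large_numbers[of h] AE_in_S
proof eventually_elim
  case (elim \<omega>)
  define B where "B = (\<Sum>y\<in>S. \<bar>h y\<bar>)"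
  have B: "\<bar>h y\<bar> \<le> B" if "y \<in> S" for y
    unfolding B_def using finite_S that by (intro member_le_sum[where f = "\<lambda>y. \<bar>h y\<bar>"]) auto
  have sum_eq: "(\<Sum>t<T. f (\<omega> t)) = real T * c + martingale h T \<omega> + (h (\<omega> 0) - h (\<omega> T))" for T
  proof -
    have "(\<Sum>t<T. f (\<omega> t)) = (\<Sum>t<T. c + (h (\<omega> (Suc t)) - step h (\<omega> t)) + (h (\<omega> t) - h (\<omega> (Suc t))))"
    proof (rule sum.cong[OF refl])
      fix t
      show "f (\<omega> t) = c + (h (\<omega> (Suc t)) - step h (\<omega> t)) + (h (\<omega> t) - h (\<omega> (Suc t)))"
        using poisson[of "\<omega> t"] elim(2) by simp
    qed
    also have "\<dots> = real T * c + martingale h T \<omega> + (h (\<omega> 0) - h (\<omega> T))"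
      unfolding sum.distrib martingale_def sum_lessThan_telescope'[of "\<lambda>t. h (\<omega> t)"] by simp
    finally show ?thesis .
  qed
  have "(\<lambda>T. (h (\<omega> 0) - h (\<omega> T)) / real T) \<longlonglongrightarrow> 0"
  proof (rule Lim_null_comparison[OF _ lim_const_over_n[of "2 * B"]], intro always_eventually allI)
    fix T
    have "\<bar>h (\<omega> 0) - h (\<omega> T)\<bar> \<le> 2 * B" using B[of "\<omega> 0"] B[of "\<omega> T"] elim(2) by force
    then show "norm ((h (\<omega> 0) - h (\<omega> T)) / real T) \<le> 2 * B / real T" by (simp add: divide_right_mono)
  qed
  then have lim: "(\<lambda>T. c + martingale h T \<omega> / real T + (h (\<omega> 0) - h (\<omega> T)) / real T) \<longlonglongrightarrow> c + 0 + 0"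
    by (intro tendsto_add tendsto_const elim(1))
  have "eventually (\<lambda>T. c + martingale h T \<omega> / real T + (h (\<omega> 0) - h (\<omega> T)) / real T
      = (\<Sum>t<T. f (\<omega> t)) / real T) sequentially"
    using eventually_gt_at_top[of 0]
    by eventually_elim (simp add: sum_eq field_simps)
  then show ?case using Lim_transform_eventually[OF lim] by simp
qed

lemma long_run_average_measurable:
  "(\<lambda>\<omega>. long_run_average (\<lambda>t. f (\<omega> t))) \<in> borel_measurable \<P>"
proof -
  have "(\<lambda>\<omega>. (\<Sum>t<T. f (\<omega> t)) / real T) \<in> borel_measurable \<P>" for T
    by (rule borel_measurable_divide[OF borel_measurable_sum borel_measurable_const])
      (rule path_function_measurable[OF space_borel])
  then show ?thesis unfolding long_run_average_def by (rule borel_measurable_lim_metric)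
qed

lemma long_run_average_AE:
  assumes "\<And>x. x \<in> S \<Longrightarrow> h x + c = f x + step h x"
  shows "AE \<omega> in \<P>. long_run_average (\<lambda>t. f (\<omega> t)) = c"
proof -
  have "AE \<omega> in \<P>. (\<lambda>T. (\<Sum>t<T. f (\<omega> t)) / real T) \<longlonglongrightarrow> c"
    by (rule strong_law) (rule assms)
  then show ?thesis by eventually_elim (simp add: long_run_average_def limI)
qed

end

lemma (in finite_chain) expectation_at:
  "(\<integral>\<omega>. g (\<omega> t) \<partial>\<P>) = (\<integral>\<omega>. (step ^^ t) g (\<omega> 0) \<partial>\<P>)"
proof (induction t arbitrary: g)
  case (Suc t)
  have "(\<integral>\<omega>. 1 * g (\<omega> (Suc t)) \<partial>\<P>) = (\<integral>\<omega>. 1 * step g (\<omega> t) \<partial>\<P>)"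
    by (rule markov_property) simp_all
  then show ?case using Suc[of "step g"] by (simp only: mult_1 funpow_Suc_right comp_apply)
qed simp

lemma (in finite_chain) integrable_at: "integrable \<P> (\<lambda>\<omega>. g (\<omega> t) :: real)"
proof (rule integrable_bounded_on_S)
  show "\<bar>g (\<omega> t)\<bar> \<le> (\<Sum>y\<in>S. \<bar>g y\<bar>)" if "\<And>t. \<omega> t \<in> S" for \<omega>
    using finite_S that[of t] by (intro member_le_sum[where f = "\<lambda>y. \<bar>g y\<bar>"]) auto
qed (rule path_function_measurable[OF space_borel])

lemma (in finite_chain) expectation_at_deterministic_start:
  assumes "\<nu> = return_pmf x"
  shows "(\<integral>\<omega>. g (\<omega> t) \<partial>\<P>) = (step ^^ t) g x"
proof -
  have "measure \<P> (cylinder 0 (\<lambda>_. x)) = 1" by (simp add: measure_cylinder assms)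
  then have "AE \<omega> in \<P>. \<omega> \<in> cylinder 0 (\<lambda>_. x)"
    using AE_in_set_eq_1[OF cylinder_sets] by blast
  then have "AE \<omega> in \<P>. (step ^^ t) g (\<omega> 0) = (step ^^ t) g x"
    by eventually_elim (simp add: cylinder_def)
  then have "(\<integral>\<omega>. (step ^^ t) g (\<omega> 0) \<partial>\<P>) = (\<integral>\<omega>. (step ^^ t) g x \<partial>\<P>)"
    by (rule integral_cong_AE[OF path_function_measurable[OF space_borel] borel_measurable_const])
  then show ?thesis unfolding expectation_at[of g t] using prob_space by simp
qed

section \<open>Mixing two stationary decisions of one player\<close>

text \<open>The mean of \<open>\<phi> s\<close> over the action drawn by a player who uses \<open>v'\<close> with probability \<open>\<delta>\<close>
  and \<open>v\<close> otherwise.\<close>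
definition mix :: "real \<Rightarrow> ('s \<Rightarrow> 'a) \<Rightarrow> ('s \<Rightarrow> 'a) \<Rightarrow> ('s \<Rightarrow> 'a \<Rightarrow> real) \<Rightarrow> 's \<Rightarrow> real" where
  "mix \<delta> v v' \<phi> s = (1 - \<delta>) * \<phi> s (v s) + \<delta> * \<phi> s (v' s)"

definition mixed_matrix :: "('s \<Rightarrow> 'a \<Rightarrow> 's pmf) \<Rightarrow> real \<Rightarrow> ('s \<Rightarrow> 'a) \<Rightarrow> ('s \<Rightarrow> 'a) \<Rightarrow> 's \<Rightarrow> 's \<Rightarrow> real" where
  "mixed_matrix p \<delta> v v' s t = mix \<delta> v v' (\<lambda>s a. pmf (p s a) t) s"

lemma mixed_matrix_stochastic:
  assumes "finite S" "S \<noteq> {}" "\<And>s. s \<in> S \<Longrightarrow> set_pmf (p s (v s)) \<subseteq> S"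
    and "\<And>s. s \<in> S \<Longrightarrow> set_pmf (p s (v' s)) \<subseteq> S" and "0 \<le> \<delta>" "\<delta> \<le> 1"
  shows "stochastic_matrix S (mixed_matrix p \<delta> v v')"
proof
  show "(\<Sum>y\<in>S. mixed_matrix p \<delta> v v' x y) = 1" if "x \<in> S" for x
    using assms that sum_pmf_eq_1[of S]
    by (simp add: mixed_matrix_def mix_def sum.distrib flip: sum_distrib_left)
qed (use assms in \<open>auto simp: mixed_matrix_def mix_def\<close>)

lemma powers_eq_n_step:
  assumes "stochastic_matrix S (mixed_matrix p 0 v v')" "\<And>s. s \<in> S \<Longrightarrow> set_pmf (p s (v s)) \<subseteq> S" "x \<in> S"
  shows "(stochastic_matrix.P S (mixed_matrix p 0 v v') ^^ n) f x
    = (\<Sum>y\<in>S. pmf (n_step (\<lambda>s. p s (v s)) n x) y * f y)"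
    and "set_pmf (n_step (\<lambda>s. p s (v s)) n x) \<subseteq> S"
proof -
  interpret stochastic_matrix S "mixed_matrix p 0 v v'" by fact
  let ?K = "\<lambda>s. p s (v s)"
  have "set_pmf (n_step ?K n x) \<subseteq> S \<and>
      (\<forall>f. (P ^^ n) f x = (\<Sum>y\<in>S. pmf (n_step ?K n x) y * f y))"
  proof (induction n)
    case 0
    have "(\<Sum>y\<in>S. pmf (return_pmf x) y * f y) = f x" for f
    proof -
      have "(\<Sum>y\<in>S. pmf (return_pmf x) y * f y) = (\<Sum>y\<in>S. if x = y then f y else 0)"
        by (intro sum.cong) (auto simp: indicator_def)
      then show ?thesis using \<open>x \<in> S\<close> fin by simp
    qed
    then show ?case using \<open>x \<in> S\<close> by simp
  next
    case (Suc n)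
    then have sub: "set_pmf (n_step ?K n x) \<subseteq> S" by blast
    have "(P ^^ Suc n) f x = (\<Sum>y\<in>S. pmf (n_step ?K (Suc n) x) y * f y)" for f
    proof -
      have "(P ^^ Suc n) f x = (\<Sum>z\<in>S. pmf (n_step ?K n x) z * P f z)"
        using Suc by (simp add: Pn_Suc[symmetric] del: funpow.simps)
      also have "\<dots> = (\<Sum>z\<in>S. \<Sum>y\<in>S. pmf (n_step ?K n x) z * pmf (?K z) y * f y)"
        by (simp add: P_def mixed_matrix_def mix_def sum_distrib_left mult.assoc)
      also have "\<dots> = (\<Sum>y\<in>S. (\<Sum>z\<in>S. pmf (?K z) y * pmf (n_step ?K n x) z) * f y)"
        by (subst sum.swap) (simp add: sum_distrib_right sum_distrib_left mult_ac)
      also have "\<dots> = (\<Sum>y\<in>S. pmf (n_step ?K (Suc n) x) y * f y)"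
        using fin sub by (simp add: pmf_bind integral_measure_pmf_real[where A = S] subset_iff)
      finally show ?thesis .
    qed
    then show ?case using sub assms(2) by auto
  qed
  then show "(P ^^ n) f x = (\<Sum>y\<in>S. pmf (n_step ?K n x) y * f y)"
    "set_pmf (n_step ?K n x) \<subseteq> S" by blast+
qed

text \<open>For \<open>\<delta> \<le> 1/2\<close> the mixed chain takes \<open>m\<close> steps according to \<open>v\<close> with probability at least
  \<open>(1/2) ^ m\<close>, so it inherits the minorization of the chain of \<open>v\<close>. The constants do not depend on
  \<open>v'\<close> or \<open>\<delta>\<close>, which is what bounds the first-order term of the variance away
  from zero along a whole mixing direction.\<close>
lemma uniform_minorization:
  assumes fin: "finite S" "S \<noteq> {}" and closed: "\<And>s. s \<in> S \<Longrightarrow> set_pmf (p s (v s)) \<subseteq> S"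
    and erg: "irreducible_on S (\<lambda>s. p s (v s))" "aperiodic_on S (\<lambda>s. p s (v s))"
  obtains m \<epsilon> where "\<epsilon> > 0"
    "\<And>v' \<delta>. (\<And>s. s \<in> S \<Longrightarrow> set_pmf (p s (v' s)) \<subseteq> S) \<Longrightarrow> 0 \<le> \<delta> \<Longrightarrow> \<delta> \<le> 1/2 \<Longrightarrow>
      minorized_chain S (mixed_matrix p \<delta> v v') m \<epsilon>"
proof -
  let ?K = "\<lambda>s. p s (v s)"
  obtain m where m: "\<And>x y. x \<in> S \<Longrightarrow> y \<in> S \<Longrightarrow> pmf (n_step ?K m x) y > 0"
    using primitive_chain[OF fin(1) erg] by blast
  define \<beta> where "\<beta> = Min ((\<lambda>(x, y). pmf (n_step ?K m x) y) ` (S \<times> S))"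
  have \<beta>: "\<beta> > 0" unfolding \<beta>_def using fin m by (subst Min_gr_iff) auto
  have \<beta>_le: "\<beta> \<le> pmf (n_step ?K m x) y" if "x \<in> S" "y \<in> S" for x y
    unfolding \<beta>_def using fin that by (intro Min_le) auto
  define \<epsilon> where "\<epsilon> = (1/2) ^ m * \<beta>"
  have \<epsilon>: "\<epsilon> > 0" using \<beta> by (simp add: \<epsilon>_def)
  have "minorized_chain S (mixed_matrix p \<delta> v v') m \<epsilon>"
    if v': "\<And>s. s \<in> S \<Longrightarrow> set_pmf (p s (v' s)) \<subseteq> S" and \<delta>: "0 \<le> \<delta>" "\<delta> \<le> 1/2" for v' \<delta>
  proof -
    interpret pure: stochastic_matrix S "mixed_matrix p 0 v v'"
      using fin closed v' by (intro mixed_matrix_stochastic) auto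
    interpret mixed: stochastic_matrix S "mixed_matrix p \<delta> v v'"
      using fin closed v' \<delta> by (intro mixed_matrix_stochastic) auto
    have half: "(1/2) ^ n * (pure.P ^^ n) f x \<le> (mixed.P ^^ n) f x"
      if "\<And>y. y \<in> S \<Longrightarrow> 0 \<le> f y" "x \<in> S" for f x n
      using that(2)
    proof (induction n arbitrary: x)
      case (Suc n)
      have nonneg: "0 \<le> (mixed.P ^^ n) f y" if "y \<in> S" for y
        using mixed.Pn_mono[of "\<lambda>_. 0" f y n] mixed.Pn_const[of y n 0] that \<open>\<And>y. y \<in> S \<Longrightarrow> 0 \<le> f y\<close>
        by simp
      have "(1/2) ^ Suc n * (pure.P ^^ Suc n) f x
          = 1/2 * pure.P (\<lambda>y. (1/2) ^ n * (pure.P ^^ n) f y + 0 * f y) x"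
        by (simp only: pure.P_linear) simp
      also have "\<dots> \<le> 1/2 * pure.P ((mixed.P ^^ n) f) x"
        using Suc by (intro mult_left_mono pure.P_mono) auto
      also have "\<dots> = (\<Sum>y\<in>S. 1/2 * pmf (?K x) y * (mixed.P ^^ n) f y)"
        by (simp add: pure.P_def mixed_matrix_def mix_def sum_distrib_left mult.assoc)
      also have "\<dots> \<le> mixed.P ((mixed.P ^^ n) f) x"
        unfolding mixed.P_def[of "(mixed.P ^^ n) f" x]
      proof (intro sum_mono mult_right_mono nonneg)
        fix y
        have "1/2 * pmf (?K x) y \<le> (1 - \<delta>) * pmf (?K x) y"
          using \<delta> by (intro mult_right_mono) auto
        then show "1/2 * pmf (?K x) y \<le> mixed_matrix p \<delta> v v' x y"
          using \<delta> by (simp add: mixed_matrix_def mix_def add_increasing2)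
      qed
      finally show ?case by simp
    qed simp
    show ?thesis
    proof
      fix f :: "'a \<Rightarrow> real" and x y
      assume f: "\<And>y. y \<in> S \<Longrightarrow> 0 \<le> f y" and xy: "x \<in> S" "y \<in> S"
      have "\<beta> * f y \<le> pmf (n_step ?K m x) y * f y"
        using \<beta>_le xy f by (intro mult_right_mono) auto
      also have "\<dots> \<le> (\<Sum>y\<in>S. pmf (n_step ?K m x) y * f y)"
        using fin xy f by (intro member_le_sum[where f = "\<lambda>y. pmf (n_step ?K m x) y * f y"]) auto
      also have "\<dots> = (pure.P ^^ m) f x"
        by (rule powers_eq_n_step(1)[symmetric]) (use closed xy pure.stochastic_matrix_axioms in auto)
      finally have "(1/2) ^ m * (\<beta> * f y) \<le> (1/2) ^ m * (pure.P ^^ m) f x"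
        by (intro mult_left_mono) auto
      then show "\<epsilon> * f y \<le> (mixed.P ^^ m) f x"
        using half[of f x m, OF f xy(1)] unfolding \<epsilon>_def mult.assoc by (rule order_trans)
    qed (rule \<epsilon>)
  qed
  then show thesis using that \<epsilon> by blast
qed

section \<open>Reduction of the joint chain to the chains of the players\<close>

locale separated_game =
  fixes G :: "('s, 'a) game" and \<nu> :: "(nat \<Rightarrow> 's) pmf"
  assumes valid: "valid_game G" and ergodic: "ergodic_game G"
    and initial: "set_pmf \<nu> \<subseteq> joint_states G"
begin

abbreviation "I \<equiv> players G"
abbreviation "S \<equiv> states G"
abbreviation "p \<equiv> trans_prob G"
abbreviation "r \<equiv> reward G"
abbreviation "n \<equiv> real (num_players G)"
abbreviation "U i \<equiv> S i \<rightarrow>\<^sub>E actions G i"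

abbreviation "W i \<equiv> mixed_matrix (p i)"

lemma finite_players: "finite I" by (simp add: players_def)
lemma num_players_pos: "n > 0" using valid by (simp add: valid_game_def)
lemma card_players: "real (card I) = n" by (simp add: players_def)

lemma player_facts:
  assumes "i \<in> I"
  shows "finite (S i)" "S i \<noteq> {}" "finite (actions G i)"
    "\<And>s a. s \<in> S i \<Longrightarrow> a \<in> actions G i \<Longrightarrow> set_pmf (p i s a) \<subseteq> S i"
  using valid assms by (auto simp: valid_game_def)

lemma closed_under: "i \<in> I \<Longrightarrow> v \<in> U i \<Longrightarrow> s \<in> S i \<Longrightarrow> set_pmf (p i s (v s)) \<subseteq> S i"
  by (rule player_facts(4)) auto

lemma SD_policy: "u \<in> SD_policies G \<Longrightarrow> i \<in> I \<Longrightarrow> u i \<in> U i"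
  by (auto simp: SD_policies_def)

lemma player_minorization:
  assumes "i \<in> I" "v \<in> U i"
  obtains m \<epsilon> where "\<epsilon> > 0"
    "\<And>v' \<delta>. v' \<in> U i \<Longrightarrow> 0 \<le> \<delta> \<Longrightarrow> \<delta> \<le> 1/2 \<Longrightarrow> minorized_chain (S i) (W i \<delta> v v') m \<epsilon>"
proof -
  have erg: "irreducible_on (S i) (\<lambda>s. p i s (v s))" "aperiodic_on (S i) (\<lambda>s. p i s (v s))"
    using ergodic assms by (auto simp: ergodic_game_def)
  show thesis
  proof (rule uniform_minorization[where S = "S i" and p = "p i" and v = v, OF player_facts(1,2)[OF assms(1)] _ erg])
    fix m \<epsilon> assume "\<epsilon> > 0" and *: "\<And>v' \<delta>. (\<And>s. s \<in> S i \<Longrightarrow> set_pmf (p i s (v' s)) \<subseteq> S i) \<Longrightarrow>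
      0 \<le> \<delta> \<Longrightarrow> \<delta> \<le> 1/2 \<Longrightarrow> minorized_chain (S i) (W i \<delta> v v') m \<epsilon>"
    show thesis
    proof (rule that[OF \<open>\<epsilon> > 0\<close>])
      show "minorized_chain (S i) (W i \<delta> v v') m \<epsilon>" if "v' \<in> U i" "0 \<le> \<delta>" "\<delta> \<le> 1/2" for v' \<delta>
        using that by (intro * closed_under[OF assms(1)])
    qed
  qed (rule closed_under[OF assms])
qed

definition player_avg :: "nat \<Rightarrow> real \<Rightarrow> ('s \<Rightarrow> 'a) \<Rightarrow> ('s \<Rightarrow> 'a) \<Rightarrow> ('s \<Rightarrow> real) \<Rightarrow> real" where
  "player_avg i \<delta> v v' = stochastic_matrix.stat_avg (S i) (W i \<delta> v v')"

definition poisson_potential :: "nat \<Rightarrow> ('s \<Rightarrow> 'a) \<Rightarrow> ('s \<Rightarrow> 'a \<Rightarrow> real) \<Rightarrow> 's \<Rightarrow> real" where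
  "poisson_potential i v \<phi> = stochastic_matrix.poisson (S i) (W i 0 v v) (mix 0 v v \<phi>)"

text \<open>Deterministic policies are the case \<open>\<delta> = 0\<close>, so that every statement about mixed policies below
  covers them.\<close>
lemma mixed_policy_zero: "mixed_policy G 0 u u' = det_policy G u"
proof
  fix s
  have "bernoulli_pmf 0 = return_pmf False"
    by (rule pmf_eqI) (auto simp: indicator_def split: bool.splits)
  then show "mixed_policy G 0 u u' s = det_policy G u s"
    using finite_players by (simp add: mixed_policy_def det_policy_def restrict_def)
qed

end

lemma PiE_dflt_undefined: "PiE_dflt A undefined B = PiE A B"
  by (auto simp: PiE_dflt_def PiE_def extensional_def Pi_def)

context separated_game
begin

lemma minorized:
  assumes "i \<in> I" "v \<in> U i" "v' \<in> U i" "0 \<le> \<delta>" "\<delta> \<le> 1/2"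
  obtains m \<epsilon> where "minorized_chain (S i) (W i \<delta> v v') m \<epsilon>"
  using player_minorization[OF assms(1,2)] assms(3-) by metis

definition long_run :: "nat \<Rightarrow> real \<Rightarrow> ('s \<Rightarrow> 'a) \<Rightarrow> ('s \<Rightarrow> 'a) \<Rightarrow> ('s \<Rightarrow> 'a \<Rightarrow> real) \<Rightarrow> real" where
  "long_run i \<delta> v v' \<phi> = player_avg i \<delta> v v' (mix \<delta> v v' \<phi>)"

definition successor_mean :: "nat \<Rightarrow> ('s \<Rightarrow> real) \<Rightarrow> 's \<Rightarrow> 'a \<Rightarrow> real" where
  "successor_mean i h s a = (\<Sum>t\<in>S i. pmf (p i s a) t * h t)"

lemma mix_successor_mean:
  assumes "stochastic_matrix (S i) (W i \<delta> v v')"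
  shows "mix \<delta> v v' (successor_mean i h) s = stochastic_matrix.P (S i) (W i \<delta> v v') h s"
  by (simp add: stochastic_matrix.P_def[OF assms] mixed_matrix_def mix_def successor_mean_def
      sum_distrib_left sum.distrib distrib_right mult.assoc)

text \<open>Written with \<open>mix\<close> applied to cost and continuation together, since this is the form that lifts to
  pairs of state and action.\<close>
lemma poisson_exists:
  assumes "i \<in> I" "v \<in> U i" "v' \<in> U i" "0 \<le> \<delta>" "\<delta> \<le> 1/2"
  obtains h where "\<And>s. s \<in> S i \<Longrightarrow>
    h s + long_run i \<delta> v v' \<phi> = mix \<delta> v v' (\<lambda>s a. \<phi> s a + successor_mean i h s a) s"
proof -
  obtain m \<epsilon> where "minorized_chain (S i) (W i \<delta> v v') m \<epsilon>" using minorized[OF assms] .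
  then interpret minorized_chain "S i" "W i \<delta> v v'" m \<epsilon> .
  let ?h = "poisson (mix \<delta> v v' \<phi>)"
  have "?h s + long_run i \<delta> v v' \<phi> = mix \<delta> v v' (\<lambda>s a. \<phi> s a + successor_mean i ?h s a) s"
    if "s \<in> S i" for s
  proof -
    have "mix \<delta> v v' (\<lambda>s a. \<phi> s a + successor_mean i ?h s a) s
        = mix \<delta> v v' \<phi> s + mix \<delta> v v' (successor_mean i ?h) s"
      by (simp add: mix_def algebra_simps)
    then show ?thesis using poisson_equation[OF that, of "mix \<delta> v v' \<phi>"]
      by (simp add: long_run_def player_avg_def mix_successor_mean[OF stochastic_matrix_axioms])
  qed
  then show thesis using that by blast
qed

definition joint_space :: "((nat \<Rightarrow> 's) \<times> (nat \<Rightarrow> 'a)) set" where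
  "joint_space = joint_states G \<times> (\<Pi>\<^sub>E i\<in>I. actions G i)"

lemma joint_state_component: "s \<in> joint_states G \<Longrightarrow> i \<in> I \<Longrightarrow> s i \<in> S i"
  by (auto simp: joint_states_def)

lemma mixed_policy_support:
  assumes "u \<in> SD_policies G" "u' \<in> SD_policies G" "s \<in> joint_states G"
  shows "set_pmf (mixed_policy G \<delta> u u' s) \<subseteq> (\<Pi>\<^sub>E i\<in>I. actions G i)"
proof -
  have "set_pmf (map_pmf (\<lambda>b. if b then u' i (s i) else u i (s i)) (bernoulli_pmf \<delta>)) \<subseteq> actions G i"
    if "i \<in> I" for i
    using SD_policy[OF assms(1) that] SD_policy[OF assms(2) that] joint_state_component[OF assms(3) that]
    by auto
  then have "PiE I (\<lambda>i. set_pmf (map_pmf (\<lambda>b. if b then u' i (s i) else u i (s i)) (bernoulli_pmf \<delta>)))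
      \<subseteq> (\<Pi>\<^sub>E i\<in>I. actions G i)"
    by (intro PiE_mono)
  then show ?thesis
    unfolding mixed_policy_def
    using set_Pi_pmf_subset'[OF finite_players, of undefined
        "\<lambda>i. map_pmf (\<lambda>b. if b then u' i (s i) else u i (s i)) (bernoulli_pmf \<delta>)"]
    unfolding PiE_dflt_undefined comp_def by (rule order_trans[rotated])
qed

lemma joint_finite_chain:
  assumes "u \<in> SD_policies G" "u' \<in> SD_policies G"
  shows "finite_chain joint_space (bind_pmf \<nu> (\<lambda>s. map_pmf (Pair s) (mixed_policy G \<delta> u u' s)))
    (joint_step G (mixed_policy G \<delta> u u'))"
proof
  show "finite joint_space"
    using finite_players player_facts by (simp add: joint_space_def joint_states_def finite_PiE)
  show "set_pmf (bind_pmf \<nu> (\<lambda>s. map_pmf (Pair s) (mixed_policy G \<delta> u u' s))) \<subseteq> joint_space"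
  proof -
    have "(s, a) \<in> joint_space"
      if "s \<in> set_pmf \<nu>" "a \<in> set_pmf (mixed_policy G \<delta> u u' s)" for s a
      using that initial mixed_policy_support[OF assms, of s \<delta>] unfolding joint_space_def by blast
    then show ?thesis by auto
  qed
  show "set_pmf (joint_step G (mixed_policy G \<delta> u u') x) \<subseteq> joint_space" if mem: "x \<in> joint_space" for x
  proof -
    obtain s a where x: "x = (s, a)" "s \<in> joint_states G" "a \<in> (\<Pi>\<^sub>E i\<in>I. actions G i)"
      using mem unfolding joint_space_def by blast
    have "set_pmf (p i (s i) (a i)) \<subseteq> S i" if "i \<in> I" for i
      using that x joint_state_component by (intro player_facts) auto
    then have "PiE I (\<lambda>i. set_pmf (p i (s i) (a i))) \<subseteq> joint_states G"
      unfolding joint_states_def by (intro PiE_mono)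
    then have sub: "set_pmf (Pi_pmf I undefined (\<lambda>i. p i (s i) (a i))) \<subseteq> joint_states G"
      using set_Pi_pmf_subset'[OF finite_players, of undefined "\<lambda>i. p i (s i) (a i)"]
      unfolding PiE_dflt_undefined comp_def by (rule order_trans[rotated])
    have "(s', a') \<in> joint_space"
      if "s' \<in> set_pmf (Pi_pmf I undefined (\<lambda>i. p i (s i) (a i)))"
        "a' \<in> set_pmf (mixed_policy G \<delta> u u' s')" for s' a'
      using that sub mixed_policy_support[OF assms, of s' \<delta>] unfolding joint_space_def by blast
    then show ?thesis by (auto simp: joint_step_def x(1))
  qed
qed

text \<open>This is where separate control and independent coins enter: the law of the next pair of player
  \<open>i\<close> depends on the joint state and action only through the current pair of player \<open>i\<close>.\<close>
lemma joint_step_component: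
  assumes "i \<in> I"
  shows "map_pmf (\<lambda>(s, a). (s i, a i)) (joint_step G (mixed_policy G \<delta> u u') (s, a))
    = bind_pmf (p i (s i) (a i))
        (\<lambda>t. map_pmf (\<lambda>b. (t, if b then u' i t else u i t)) (bernoulli_pmf \<delta>))"
proof -
  let ?k = "\<lambda>t. map_pmf (\<lambda>b. (t, if b then u' i t else u i t)) (bernoulli_pmf \<delta>)"
  let ?A = "Pi_pmf I undefined (\<lambda>i. p i (s i) (a i))"
  have "map_pmf (\<lambda>a'. (s' i, a' i)) (mixed_policy G \<delta> u u' s') = ?k (s' i)" for s'
  proof -
    have "map_pmf (\<lambda>a'. (s' i, a' i)) (mixed_policy G \<delta> u u' s')
        = map_pmf (Pair (s' i)) (map_pmf (\<lambda>a'. a' i) (mixed_policy G \<delta> u u' s'))"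
      by (simp add: pmf.map_comp comp_def)
    also have "\<dots> = ?k (s' i)"
      using assms finite_players
      by (simp add: mixed_policy_def Pi_pmf_component pmf.map_comp comp_def)
    finally show ?thesis .
  qed
  then have "map_pmf (\<lambda>(s, a). (s i, a i)) (joint_step G (mixed_policy G \<delta> u u') (s, a))
      = bind_pmf ?A (\<lambda>s'. ?k (s' i))"
    by (simp add: joint_step_def map_bind_pmf pmf.map_comp comp_def)
  also have "\<dots> = bind_pmf (map_pmf (\<lambda>s'. s' i) ?A) ?k" by (simp add: bind_map_pmf)
  also have "map_pmf (\<lambda>s'. s' i) ?A = p i (s i) (a i)"
    using assms finite_players by (simp add: Pi_pmf_component)
  finally show ?thesis .
qed

lemma expectation_joint_step:
  assumes "i \<in> I" "(s, a) \<in> joint_space" "0 \<le> \<delta>" "\<delta> \<le> 1"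
  shows "measure_pmf.expectation (joint_step G (mixed_policy G \<delta> u u') (s, a)) (\<lambda>x. H (fst x i) (snd x i))
    = successor_mean i (mix \<delta> (u i) (u' i) H) (s i) (a i)"
proof -
  have "measure_pmf.expectation (joint_step G (mixed_policy G \<delta> u u') (s, a)) (\<lambda>x. H (fst x i) (snd x i))
     = measure_pmf.expectation (map_pmf (\<lambda>(s, a). (s i, a i)) (joint_step G (mixed_policy G \<delta> u u') (s, a)))
         (\<lambda>(t, b). H t b)"
    by (simp add: case_prod_unfold)
  also have "\<dots> = (\<Sum>t\<in>S i. pmf (p i (s i) (a i)) t *\<^sub>R measure_pmf.expectation
      (map_pmf (\<lambda>b. (t, if b then u' i t else u i t)) (bernoulli_pmf \<delta>)) (\<lambda>(t, b). H t b))"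
    unfolding joint_step_component[OF assms(1)]
    using assms by (intro pmf_expectation_bind player_facts) (auto simp: joint_space_def joint_states_def)
  also have "\<dots> = successor_mean i (mix \<delta> (u i) (u' i) H) (s i) (a i)"
    using assms(3,4) by (simp add: successor_mean_def mix_def mult.commute add.commute)
  finally show ?thesis .
qed

lemma successor_mean_add_const:
  assumes "i \<in> I" "s \<in> S i" "a \<in> actions G i"
  shows "successor_mean i (\<lambda>t. h t + c) s a = successor_mean i h s a + c"
  using sum_pmf_eq_1[OF player_facts(1)[OF assms(1)] player_facts(4)[OF assms]]
  by (simp add: successor_mean_def distrib_left sum.distrib flip: sum_distrib_right)

context
  fixes u u' :: "nat \<Rightarrow> 's \<Rightarrow> 'a" and \<delta> :: real
  assumes u: "u \<in> SD_policies G" "u' \<in> SD_policies G" and \<delta>: "0 \<le> \<delta>" "\<delta> \<le> 1/2"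
begin

text \<open>If \<open>h\<close> solves the Poisson equation of the state chain of player \<open>i\<close>, then
  \<open>H s a = \<phi> s a + successor_mean i h s a\<close>, read at the pair of player \<open>i\<close>, solves the one of the
  joint chain, and the strong law applies.\<close>
lemma joint_long_run:
  assumes i: "i \<in> I"
  shows "AE \<omega> in play_law G \<nu> (mixed_policy G \<delta> u u').
    long_run_average (\<lambda>t. \<phi> (fst (\<omega> t) i) (snd (\<omega> t) i)) = long_run i \<delta> (u i) (u' i) \<phi>"
proof -
  interpret finite_chain joint_space "bind_pmf \<nu> (\<lambda>s. map_pmf (Pair s) (mixed_policy G \<delta> u u' s))"
    "joint_step G (mixed_policy G \<delta> u u')"
    using u by (rule joint_finite_chain)
  let ?c = "long_run i \<delta> (u i) (u' i) \<phi>"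
  obtain h where h: "\<And>s. s \<in> S i \<Longrightarrow>
      h s + ?c = mix \<delta> (u i) (u' i) (\<lambda>s a. \<phi> s a + successor_mean i h s a) s"
    using poisson_exists[OF i SD_policy[OF u(1) i] SD_policy[OF u(2) i] \<delta>] by blast
  define H where "H = (\<lambda>s a. \<phi> s a + successor_mean i h s a)"
  show ?thesis unfolding play_law_def
  proof (rule long_run_average_AE[where f = "\<lambda>x. \<phi> (fst x i) (snd x i)"])
    fix x assume x: "x \<in> joint_space"
    obtain s a where sa: "x = (s, a)" by (cases x)
    have mem: "s i \<in> S i" "a i \<in> actions G i"
      using x i by (auto simp: sa joint_space_def joint_states_def)
    have "step (\<lambda>x. H (fst x i) (snd x i)) x = successor_mean i (mix \<delta> (u i) (u' i) H) (s i) (a i)"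
      unfolding step_def sa using i x \<delta> by (intro expectation_joint_step) (auto simp: sa)
    also have "\<dots> = successor_mean i (\<lambda>t. h t + ?c) (s i) (a i)"
      unfolding successor_mean_def using h by (simp add: H_def)
    also have "\<dots> = successor_mean i h (s i) (a i) + ?c"
      using i mem by (rule successor_mean_add_const)
    finally show "H (fst x i) (snd x i) + ?c
        = \<phi> (fst x i) (snd x i) + step (\<lambda>x. H (fst x i) (snd x i)) x"
      by (simp add: H_def sa)
  qed
qed

lemma expected_team_average:
  "(\<integral>\<omega>. (\<Sum>i\<in>I. long_run_average (\<lambda>t. \<phi> i (fst (\<omega> t) i) (snd (\<omega> t) i)))
      \<partial>play_law G \<nu> (mixed_policy G \<delta> u u')) = (\<Sum>i\<in>I. long_run i \<delta> (u i) (u' i) (\<phi> i))"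
proof -
  interpret finite_chain joint_space "bind_pmf \<nu> (\<lambda>s. map_pmf (Pair s) (mixed_policy G \<delta> u u' s))"
    "joint_step G (mixed_policy G \<delta> u u')"
    using u by (rule joint_finite_chain)
  let ?f = "\<lambda>\<omega>. \<Sum>i\<in>I. long_run_average (\<lambda>t. \<phi> i (fst (\<omega> t) i) (snd (\<omega> t) i))"
  let ?c = "\<Sum>i\<in>I. long_run i \<delta> (u i) (u' i) (\<phi> i)"
  have "AE \<omega> in \<P>. \<forall>i\<in>I. long_run_average (\<lambda>t. \<phi> i (fst (\<omega> t) i) (snd (\<omega> t) i))
      = long_run i \<delta> (u i) (u' i) (\<phi> i)"
    using finite_players by (rule AE_finite_allI) (rule joint_long_run[unfolded play_law_def])
  then have "AE \<omega> in \<P>. ?f \<omega> = ?c" by eventually_elim simp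
  then have "(\<integral>\<omega>. ?f \<omega> \<partial>\<P>) = (\<integral>\<omega>. ?c \<partial>\<P>)"
    by (rule integral_cong_AE[OF borel_measurable_sum[OF
          long_run_average_measurable[where f = "\<lambda>x. \<phi> i (fst x i) (snd x i)" for i]] borel_measurable_const])
  also have "\<dots> = ?c" using prob_space by simp
  finally show ?thesis by (simp add: play_law_def)
qed

lemma team_mean_eq:
  "team_mean G \<nu> (mixed_policy G \<delta> u u') = (\<Sum>i\<in>I. long_run i \<delta> (u i) (u' i) (r i)) / n"
  unfolding team_mean_def reward_at_def
  by (simp add: expected_team_average[of r])

lemma team_variance_eq:
  "team_variance G \<nu> (mixed_policy G \<delta> u u')
    = (\<Sum>i\<in>I. long_run i \<delta> (u i) (u' i) (\<lambda>s a. (r i s a - team_mean G \<nu> (mixed_policy G \<delta> u u'))\<^sup>2))"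
  unfolding team_variance_def reward_at_def
  by (rule expected_team_average[of "\<lambda>i s a. (r i s a - team_mean G \<nu> (mixed_policy G \<delta> u u'))\<^sup>2"])

end

end

section \<open>Potentials, performance differences and the shape of the team variance\<close>

context separated_game
begin

text \<open>Under a deterministic policy the chain of pairs lives on the graph of \<open>v\<close>; restricting to the
  graph identifies it with the state chain.\<close>
lemma player_finite_chain:
  assumes "i \<in> I" "v \<in> U i" "set_pmf q \<subseteq> S i"
  shows "finite_chain ((\<lambda>s. (s, v s)) ` S i) (map_pmf (\<lambda>s. (s, v s)) q)
    (\<lambda>(s, a). map_pmf (\<lambda>s'. (s', v s')) (p i s a))"
  using player_facts(1)[OF assms(1)] closed_under[OF assms(1,2)] assms(3)
  by unfold_locales (auto simp: image_iff subset_iff)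

lemma player_step:
  assumes "i \<in> I" "v \<in> U i" "set_pmf q \<subseteq> S i" "s \<in> S i"
  shows "finite_chain.step (\<lambda>(s, a). map_pmf (\<lambda>s'. (s', v s')) (p i s a)) H (s, v s)
    = successor_mean i (\<lambda>t. H (t, v t)) s (v s)"
proof -
  interpret finite_chain "(\<lambda>s. (s, v s)) ` S i" "map_pmf (\<lambda>s. (s, v s)) q"
    "\<lambda>(s, a). map_pmf (\<lambda>s'. (s', v s')) (p i s a)"
    using assms(1-3) by (rule player_finite_chain)
  have "step H (s, v s) = measure_pmf.expectation (p i s (v s)) (\<lambda>t. H (t, v t))"
    by (simp add: step_def)
  also have "\<dots> = (\<Sum>t\<in>S i. H (t, v t) * pmf (p i s (v s)) t)"
    using player_facts(1) closed_under assms by (intro integral_measure_pmf_real) blast+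
  finally show ?thesis by (simp add: successor_mean_def mult.commute)
qed

lemma pseudo_variance_eq:
  assumes i: "i \<in> I" and v: "v \<in> U i"
  shows "pseudo_variance G \<nu> i v y = long_run i 0 v v (\<lambda>s a. (r i s a - y)\<^sup>2)"
proof -
  let ?q = "map_pmf (\<lambda>s. s i) \<nu>"
  have q: "set_pmf ?q \<subseteq> S i" using initial joint_state_component[OF _ i] by auto
  interpret finite_chain "(\<lambda>s. (s, v s)) ` S i" "map_pmf (\<lambda>s. (s, v s)) ?q"
    "\<lambda>(s, a). map_pmf (\<lambda>s'. (s', v s')) (p i s a)"
    using i v q by (rule player_finite_chain)
  let ?\<phi> = "\<lambda>s a. (r i s a - y)\<^sup>2" and ?c = "long_run i 0 v v (\<lambda>s a. (r i s a - y)\<^sup>2)"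
  obtain h where h: "\<And>s. s \<in> S i \<Longrightarrow> h s + ?c = mix 0 v v (\<lambda>s a. ?\<phi> s a + successor_mean i h s a) s"
    using poisson_exists[OF i v v, of 0 ?\<phi>] by auto
  have "AE \<omega> in \<P>. long_run_average (\<lambda>t. sq_dev G i y (\<omega> t)) = ?c"
  proof (rule long_run_average_AE)
    fix x assume "x \<in> (\<lambda>s. (s, v s)) ` S i"
    then obtain s where s: "s \<in> S i" "x = (s, v s)" by auto
    show "h (fst x) + ?c = sq_dev G i y x + step (\<lambda>x. h (fst x)) x"
      using h[OF s(1)] unfolding s(2) player_step[OF i v q s(1)] by (simp add: mix_def sq_dev_def)
  qed
  then have "(\<integral>\<omega>. long_run_average (\<lambda>t. sq_dev G i y (\<omega> t)) \<partial>\<P>) = (\<integral>\<omega>. ?c \<partial>\<P>)"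
    by (rule integral_cong_AE[OF long_run_average_measurable borel_measurable_const])
  also have "\<dots> = ?c" using prob_space by simp
  finally show ?thesis unfolding pseudo_variance_def player_law_def .
qed

text \<open>The expectation of the cost at time \<open>t\<close> is the \<open>t\<close>-th power of the transition matrix applied to
  the cost, so the partial sums are those of the series defining the Poisson solution.\<close>
lemma potential_eq:
  assumes i: "i \<in> I" and v: "v \<in> U i" and s: "s \<in> S i"
  shows "potential G \<nu> i v y s = poisson_potential i v (\<lambda>s a. (r i s a - y)\<^sup>2) s"
proof -
  have q: "set_pmf (return_pmf s) \<subseteq> S i" using s by simp
  interpret finite_chain "(\<lambda>s. (s, v s)) ` S i" "map_pmf (\<lambda>s. (s, v s)) (return_pmf s)"
    "\<lambda>(s, a). map_pmf (\<lambda>s'. (s', v s')) (p i s a)"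
    using i v q by (rule player_finite_chain)
  obtain m \<epsilon> where "minorized_chain (S i) (W i 0 v v) m \<epsilon>" using minorized[OF i v v, of 0] by auto
  then interpret solo: minorized_chain "S i" "W i 0 v v" m \<epsilon> .
  define f where "f = mix 0 v v (\<lambda>s a. (r i s a - y)\<^sup>2)"
  have f: "f t = sq_dev G i y (t, v t)" for t by (simp add: f_def mix_def sq_dev_def)
  let ?c = "solo.stat_avg f"
  have c: "pseudo_variance G \<nu> i v y = ?c"
    by (simp add: pseudo_variance_eq[OF i v] long_run_def player_avg_def f_def)
  have powers: "(step ^^ t) (sq_dev G i y) (s, v s) = (solo.P ^^ t) f s" if "s \<in> S i" for t s
    using that
  proof (induction t arbitrary: s)
    case (Suc t)
    have "(step ^^ Suc t) (sq_dev G i y) (s, v s)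
        = successor_mean i (\<lambda>t'. (step ^^ t) (sq_dev G i y) (t', v t')) s (v s)"
      using player_step[OF i v q Suc.prems] by simp
    also have "\<dots> = successor_mean i ((solo.P ^^ t) f) s (v s)"
      using Suc.IH by (simp add: successor_mean_def)
    also have "\<dots> = solo.P ((solo.P ^^ t) f) s"
      using mix_successor_mean[OF solo.stochastic_matrix_axioms, of "(solo.P ^^ t) f" s]
      by (simp add: mix_def)
    finally show ?case by simp
  qed (simp add: f)
  have "(\<integral>\<omega>. (\<Sum>t<T. sq_dev G i y (\<omega> t) - ?c) \<partial>\<P>) = (\<Sum>t<T. (solo.P ^^ t) f s - ?c)" for T
  proof -
    have "(\<integral>\<omega>. (\<Sum>t<T. sq_dev G i y (\<omega> t) - ?c) \<partial>\<P>)
        = (\<Sum>t<T. (\<integral>\<omega>. sq_dev G i y (\<omega> t) - ?c \<partial>\<P>))"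
      by (rule Bochner_Integration.integral_sum,
          rule Bochner_Integration.integrable_diff[OF integrable_at integrable_const])
    also have "\<dots> = (\<Sum>t<T. (\<integral>\<omega>. sq_dev G i y (\<omega> t) \<partial>\<P>) - ?c)"
      unfolding Bochner_Integration.integral_diff[OF integrable_at integrable_const]
      using prob_space by simp
    also have "\<dots> = (\<Sum>t<T. (solo.P ^^ t) f s - ?c)"
      using expectation_at_deterministic_start[of "(s, v s)" "sq_dev G i y"] powers[OF s] by simp
    finally show ?thesis .
  qed
  then have "potential G \<nu> i v y s = lim (\<lambda>T. \<Sum>t<T. (solo.P ^^ t) f s - ?c)"
    unfolding potential_def player_law_def c by simp
  also have "\<dots> = (\<Sum>t. (solo.P ^^ t) f s - ?c)"
    by (rule limI[OF summable_LIMSEQ[OF solo.poisson_summable[OF s]]])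
  finally show ?thesis by (simp add: poisson_potential_def solo.poisson_def f_def)
qed

lemma long_run_affine:
  assumes "i \<in> I" "v \<in> U i" "v' \<in> U i" "0 \<le> \<delta>" "\<delta> \<le> 1/2"
  shows "long_run i \<delta> v v' (\<lambda>s a. \<phi> s a + b * \<psi> s a + c)
    = long_run i \<delta> v v' \<phi> + b * long_run i \<delta> v v' \<psi> + c"
proof -
  obtain m \<epsilon> where "minorized_chain (S i) (W i \<delta> v v') m \<epsilon>" using minorized[OF assms] .
  then interpret minorized_chain "S i" "W i \<delta> v v'" m \<epsilon> .
  have "mix \<delta> v v' (\<lambda>s a. \<phi> s a + b * \<psi> s a + c)
      = (\<lambda>s. 1 * (1 * mix \<delta> v v' \<phi> s + b * mix \<delta> v v' \<psi> s) + 1 * c)"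
    by (auto simp: mix_def algebra_simps)
  then show ?thesis unfolding long_run_def player_avg_def by (simp only: stat_avg_linear stat_avg_const) simp
qed

text \<open>The parallel axis identity: the deviations from the team mean sum to zero over the players, so
  moving the reference point from the mean to \<open>y\<close> changes the sum of squares by \<open>n (\<mu> - y)\<^sup>2\<close>.\<close>
lemma variance_about:
  assumes u: "u \<in> SD_policies G" "u' \<in> SD_policies G" and \<delta>: "0 \<le> \<delta>" "\<delta> \<le> 1/2"
  shows "team_variance G \<nu> (mixed_policy G \<delta> u u')
    = (\<Sum>i\<in>I. long_run i \<delta> (u i) (u' i) (\<lambda>s a. (r i s a - y)\<^sup>2))
      - n * (team_mean G \<nu> (mixed_policy G \<delta> u u') - y)\<^sup>2"
proof -
  define \<mu> where "\<mu> = team_mean G \<nu> (mixed_policy G \<delta> u u')"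
  have sum_r: "(\<Sum>i\<in>I. long_run i \<delta> (u i) (u' i) (r i)) = n * \<mu>"
    using num_players_pos by (simp add: \<mu>_def team_mean_eq[OF u \<delta>])
  have sq: "(\<lambda>s a. (r i s a - \<mu>)\<^sup>2)
      = (\<lambda>s a. (r i s a - y)\<^sup>2 + (-2 * (\<mu> - y)) * r i s a + (\<mu>\<^sup>2 - y\<^sup>2))" for i
    by (intro ext) (simp add: power2_eq_square algebra_simps)
  have "team_variance G \<nu> (mixed_policy G \<delta> u u')
      = (\<Sum>i\<in>I. long_run i \<delta> (u i) (u' i) (\<lambda>s a. (r i s a - y)\<^sup>2)
          + (-2 * (\<mu> - y)) * long_run i \<delta> (u i) (u' i) (r i) + (\<mu>\<^sup>2 - y\<^sup>2))"
    unfolding team_variance_eq[OF u \<delta>] \<mu>_def[symmetric] sq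
    by (intro sum.cong refl long_run_affine SD_policy[OF u(1)] SD_policy[OF u(2)] \<delta>)
  also have "\<dots> = (\<Sum>i\<in>I. long_run i \<delta> (u i) (u' i) (\<lambda>s a. (r i s a - y)\<^sup>2))
      + (-2 * (\<mu> - y)) * (n * \<mu>) + n * (\<mu>\<^sup>2 - y\<^sup>2)"
    by (simp only: sum.distrib sum_distrib_left[symmetric] sum_r sum_constant card_players)
  also have "\<dots> = (\<Sum>i\<in>I. long_run i \<delta> (u i) (u' i) (\<lambda>s a. (r i s a - y)\<^sup>2)) - n * (\<mu> - y)\<^sup>2"
    by (simp add: power2_eq_square algebra_simps)
  finally show ?thesis by (simp add: \<mu>_def)
qed

text \<open>The average of \<open>P h - h\<close> vanishes for the new chain. Adding it to the average of the new cost
  and subtracting the Poisson equation of the reference decision \<open>v0\<close> leaves the advantages of the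
  new actions, averaged over the stationary distribution of the new chain.\<close>
lemma performance_difference:
  assumes "i \<in> I" "v \<in> U i" "v' \<in> U i" "0 \<le> \<delta>" "\<delta> \<le> 1/2"
    and poisson: "\<And>s. s \<in> S i \<Longrightarrow> h s + c = \<phi> s (v0 s) + successor_mean i h s (v0 s)"
    and Q: "\<And>s a. s \<in> S i \<Longrightarrow> Q s a = \<phi> s a + successor_mean i h s a"
  shows "long_run i \<delta> v v' \<phi> - c = player_avg i \<delta> v v' (\<lambda>s. mix \<delta> v v' Q s - Q s (v0 s))"
proof -
  obtain m \<epsilon> where "minorized_chain (S i) (W i \<delta> v v') m \<epsilon>" using minorized[OF assms(1-5)] .
  then interpret minorized_chain "S i" "W i \<delta> v v'" m \<epsilon> .
  have "stat_avg (\<lambda>s. mix \<delta> v v' Q s - Q s (v0 s))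
      = stat_avg (\<lambda>s. 1 * (1 * mix \<delta> v v' \<phi> s + 1 * P h s) + (-1) * (1 * h s + 1 * c))"
  proof (rule stat_avg_cong)
    fix s assume s: "s \<in> S i"
    have "mix \<delta> v v' Q s = mix \<delta> v v' \<phi> s + mix \<delta> v v' (successor_mean i h) s"
      using Q[OF s] by (simp add: mix_def algebra_simps)
    then show "mix \<delta> v v' Q s - Q s (v0 s)
        = 1 * (1 * mix \<delta> v v' \<phi> s + 1 * P h s) + (-1) * (1 * h s + 1 * c)"
      using poisson[OF s] Q[OF s] by (simp add: mix_successor_mean[OF stochastic_matrix_axioms])
  qed
  then show ?thesis
    unfolding long_run_def player_avg_def by (simp only: stat_avg_linear stat_avg_const stat_avg_P) simp
qed

end

context separated_game
begin

abbreviation "Q \<equiv> improvement_value G \<nu>"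

lemma improvement_value_eq:
  assumes "u \<in> SD_policies G" "i \<in> I" and y: "y = team_mean G \<nu> (det_policy G u)"
  shows "Q u i s a = (r i s a - y)\<^sup>2 + successor_mean i (poisson_potential i (u i) (\<lambda>s a. (r i s a - y)\<^sup>2)) s a"
  using potential_eq[OF assms(2) SD_policy[OF assms(1,2)]]
  by (simp add: improvement_value_def successor_mean_def y Let_def)

lemma poisson_potential_equation:
  assumes "i \<in> I" "v \<in> U i" "s \<in> S i"
  shows "poisson_potential i v \<phi> s + long_run i 0 v v \<phi> = \<phi> s (v s) + successor_mean i (poisson_potential i v \<phi>) s (v s)"
proof -
  obtain m \<epsilon> where "minorized_chain (S i) (W i 0 v v) m \<epsilon>"
    using minorized[OF assms(1,2,2), of 0] by auto
  then interpret minorized_chain "S i" "W i 0 v v" m \<epsilon> .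
  show ?thesis
    using poisson_equation[OF assms(3), of "mix 0 v v \<phi>"]
      mix_successor_mean[OF stochastic_matrix_axioms, of "poisson_potential i v \<phi>" s]
    by (simp add: poisson_potential_def long_run_def player_avg_def mix_def)
qed

text \<open>The performance difference for the squared deviations from the fixed level \<open>y\<close>, the mean under \<open>u\<close>,
  combined with the parallel axis identity. Under \<open>u\<close> itself the correction term is zero.\<close>
theorem variance_difference:
  assumes u: "u \<in> SD_policies G" and w: "w \<in> SD_policies G" "w' \<in> SD_policies G"
    and \<delta>: "0 \<le> \<delta>" "\<delta> \<le> 1/2"
  shows "team_variance G \<nu> (mixed_policy G \<delta> w w') - team_variance G \<nu> (det_policy G u)
    = (\<Sum>i\<in>I. player_avg i \<delta> (w i) (w' i) (\<lambda>s. mix \<delta> (w i) (w' i) (Q u i) s - Q u i s (u i s)))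
      - n * (team_mean G \<nu> (mixed_policy G \<delta> w w') - team_mean G \<nu> (det_policy G u))\<^sup>2"
proof -
  define y where "y = team_mean G \<nu> (det_policy G u)"
  let ?\<phi> = "\<lambda>i s a. (r i s a - y)\<^sup>2"
  have "team_variance G \<nu> (det_policy G u) = (\<Sum>i\<in>I. long_run i 0 (u i) (u i) (?\<phi> i))"
    using team_variance_eq[OF u u, of 0] by (simp add: mixed_policy_zero y_def)
  moreover have "long_run i \<delta> (w i) (w' i) (?\<phi> i) - long_run i 0 (u i) (u i) (?\<phi> i)
      = player_avg i \<delta> (w i) (w' i) (\<lambda>s. mix \<delta> (w i) (w' i) (Q u i) s - Q u i s (u i s))" if i: "i \<in> I" for i
    using poisson_potential_equation[OF i SD_policy[OF u i], of _ "?\<phi> i"] improvement_value_eq[OF u i y_def]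
    by (intro performance_difference[OF i SD_policy[OF w(1) i] SD_policy[OF w(2) i] \<delta>])
  ultimately show ?thesis
    unfolding variance_about[OF w \<delta>, of y] y_def[symmetric]
    by (simp add: sum_subtractf[symmetric])
qed

text \<open>Because the rule keeps a minimizing action, every change of action is a strict gain,
  and a gain at one state counts since that state has positive stationary mass.\<close>
lemma improvement_decreases_variance:
  assumes u: "u \<in> SD_policies G" and w: "w \<in> improvements G \<nu> u" and neq: "w \<noteq> u"
  shows "team_variance G \<nu> (det_policy G w) < team_variance G \<nu> (det_policy G u)"
proof -
  have wSD: "w \<in> SD_policies G" and wmin: "\<And>i s. i \<in> I \<Longrightarrow> s \<in> S i \<Longrightarrow> w i s \<in> minimizers G \<nu> u i s"
    and keep: "\<And>i s. i \<in> I \<Longrightarrow> s \<in> S i \<Longrightarrow> u i s \<in> minimizers G \<nu> u i s \<Longrightarrow> w i s = u i s"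
    using w by (auto simp: improvements_def)
  have uA: "u i s \<in> actions G i" if "i \<in> I" "s \<in> S i" for i s
    using SD_policy[OF u that(1)] that(2) by auto
  define gain where "gain = (\<lambda>i s. Q u i s (u i s) - Q u i s (w i s))"
  have gain: "0 \<le> gain i s" if "i \<in> I" "s \<in> S i" for i s
    using wmin[OF that] uA[OF that] by (auto simp: gain_def minimizers_def is_arg_min_linorder)
  have stat_gain: "player_avg i 0 (w i) (w i) (\<lambda>s. mix 0 (w i) (w i) (Q u i) s - Q u i s (u i s))
      = - player_avg i 0 (w i) (w i) (gain i) \<and> 0 \<le> player_avg i 0 (w i) (w i) (gain i)
      \<and> ((\<exists>s\<in>S i. 0 < gain i s) \<longrightarrow> 0 < player_avg i 0 (w i) (w i) (gain i))" if i: "i \<in> I" for i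
  proof -
    obtain m \<epsilon> where "minorized_chain (S i) (W i 0 (w i) (w i)) m \<epsilon>"
      using minorized[OF i SD_policy[OF wSD i] SD_policy[OF wSD i], of 0] by auto
    then interpret minorized_chain "S i" "W i 0 (w i) (w i)" m \<epsilon> .
    have "(\<lambda>s. mix 0 (w i) (w i) (Q u i) s - Q u i s (u i s)) = (\<lambda>s. (-1) * gain i s + 0 * gain i s)"
      by (auto simp: mix_def gain_def)
    then have "stat_avg (\<lambda>s. mix 0 (w i) (w i) (Q u i) s - Q u i s (u i s)) = - stat_avg (gain i)"
      by (simp only: stat_avg_linear)
    moreover have lower: "\<epsilon> * gain i s \<le> stat_avg (gain i)" if "s \<in> S i" for s
      using stat_avg_lower[of "gain i" s] gain[OF i] that by blast
    moreover have "0 \<le> stat_avg (gain i)"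
      using stat_avg_mono[of "\<lambda>_. 0" "gain i"] gain[OF i] by (simp add: stat_avg_const)
    moreover have "0 < stat_avg (gain i)" if "s \<in> S i" "0 < gain i s" for s
      using lower[OF that(1)] mult_pos_pos[OF \<epsilon>_pos that(2)] by linarith
    ultimately show ?thesis unfolding player_avg_def by blast
  qed
  have "\<exists>i\<in>I. \<exists>s\<in>S i. w i s \<noteq> u i s"
  proof (rule ccontr)
    assume eq: "\<not> ?thesis"
    have "w = u"
    proof (rule PiE_ext[OF wSD[unfolded SD_policies_def] u[unfolded SD_policies_def]])
      show "w i = u i" if "i \<in> I" for i
        using SD_policy[OF wSD that] SD_policy[OF u that] eq that by (intro PiE_ext) auto
    qed
    then show False using neq by simp
  qed
  then obtain i s where changed: "i \<in> I" "s \<in> S i" "w i s \<noteq> u i s" by blast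
  then have "u i s \<notin> minimizers G \<nu> u i s" using keep by blast
  then have "0 < gain i s"
    using wmin[OF changed(1,2)] uA[OF changed(1,2)] by (force simp: minimizers_def is_arg_min_def gain_def)
  then have pos: "0 < player_avg i 0 (w i) (w i) (gain i)" using stat_gain[OF changed(1)] changed(2) by blast
  have "0 < (\<Sum>i\<in>I. player_avg i 0 (w i) (w i) (gain i))"
    using finite_players changed(1) pos stat_gain by (intro sum_pos2) auto
  moreover have "team_variance G \<nu> (det_policy G w) - team_variance G \<nu> (det_policy G u)
      \<le> - (\<Sum>i\<in>I. player_avg i 0 (w i) (w i) (gain i))"
    using variance_difference[OF u wSD wSD, of 0] stat_gain num_players_pos
    by (simp add: mixed_policy_zero sum_negf)
  ultimately show ?thesis by simp
qed

text \<open>The performance difference for the rewards: the mixed advantage is \<open>\<delta>\<close> times a bounded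
  function.\<close>
lemma mean_lipschitz:
  assumes u: "u \<in> SD_policies G" and u': "u' \<in> SD_policies G"
  obtains C where "\<And>\<delta>. 0 \<le> \<delta> \<Longrightarrow> \<delta> \<le> 1/2 \<Longrightarrow>
    \<bar>team_mean G \<nu> (mixed_policy G \<delta> u u') - team_mean G \<nu> (det_policy G u)\<bar> \<le> C * \<delta>"
proof -
  define R where "R = (\<lambda>i s a. r i s a + successor_mean i (poisson_potential i (u i) (r i)) s a)"
  define gap where "gap = (\<lambda>i s. R i s (u' i s) - R i s (u i s))"
  define B where "B = (\<lambda>i. \<Sum>s\<in>S i. \<bar>gap i s\<bar>)"
  have "\<bar>team_mean G \<nu> (mixed_policy G \<delta> u u') - team_mean G \<nu> (det_policy G u)\<bar>
      \<le> ((\<Sum>i\<in>I. B i) / n) * \<delta>" if \<delta>: "0 \<le> \<delta>" "\<delta> \<le> 1/2" for \<delta>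
  proof -
    let ?d = "\<lambda>i. long_run i \<delta> (u i) (u' i) (r i) - long_run i 0 (u i) (u i) (r i)"
    have d: "\<bar>?d i\<bar> \<le> \<delta> * B i" if i: "i \<in> I" for i
    proof -
      obtain m \<epsilon> where "minorized_chain (S i) (W i \<delta> (u i) (u' i)) m \<epsilon>"
        using minorized[OF i SD_policy[OF u i] SD_policy[OF u' i] \<delta>] .
      then interpret minorized_chain "S i" "W i \<delta> (u i) (u' i)" m \<epsilon> .
      have "?d i = stat_avg (\<lambda>s. mix \<delta> (u i) (u' i) (R i) s - R i s (u i s))"
        unfolding player_avg_def[symmetric]
        using poisson_potential_equation[OF i SD_policy[OF u i], of _ "r i"]
        by (intro performance_difference[OF i SD_policy[OF u i] SD_policy[OF u' i] \<delta>])
          (simp_all add: R_def)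
      also have "(\<lambda>s. mix \<delta> (u i) (u' i) (R i) s - R i s (u i s)) = (\<lambda>s. \<delta> * gap i s)"
        by (auto simp: mix_def gap_def algebra_simps)
      finally have eq: "?d i = stat_avg (\<lambda>s. \<delta> * gap i s)" .
      have bound: "\<bar>\<delta> * gap i s\<bar> \<le> \<delta> * B i" if "s \<in> S i" for s
        unfolding abs_mult B_def using \<delta> that player_facts(1)[OF i]
        by (auto intro!: mult_left_mono member_le_sum[where f = "\<lambda>s. \<bar>gap i s\<bar>"])
      have "stat_avg (\<lambda>s. \<delta> * gap i s) \<le> stat_avg (\<lambda>_. \<delta> * B i)"
        "stat_avg (\<lambda>_. - (\<delta> * B i)) \<le> stat_avg (\<lambda>s. \<delta> * gap i s)"
        by (rule stat_avg_mono, use bound in fastforce)+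
      then show ?thesis by (simp add: eq stat_avg_const)
    qed
    have "\<bar>\<Sum>i\<in>I. ?d i\<bar> \<le> (\<Sum>i\<in>I. \<delta> * B i)"
      using d by (intro order_trans[OF sum_abs sum_mono])
    moreover have "team_mean G \<nu> (mixed_policy G \<delta> u u') - team_mean G \<nu> (det_policy G u)
        = (\<Sum>i\<in>I. ?d i) / n"
      using team_mean_eq[OF u u' \<delta>] team_mean_eq[OF u u, of 0]
      by (simp add: mixed_policy_zero sum_subtractf diff_divide_distrib)
    ultimately show ?thesis
      using num_players_pos by (simp add: divide_right_mono sum_distrib_left[symmetric] mult.commute)
  qed
  then show thesis by (rule that)
qed

text \<open>The advantages \<open>gap\<close> of the alternative actions are nonnegative at a fixed point, and the two cases
  are whether one of them is positive.\<close>
theorem fixed_point_optimality: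
  assumes u: "u \<in> SD_policies G" and fixed: "u \<in> improvements G \<nu> u" and u': "u' \<in> SD_policies G"
  shows "strict_local_min_along G \<nu> u u' \<or> stationary_along G \<nu> u u'"
proof -
  define J where "J = (\<lambda>\<delta>. team_variance G \<nu> (mixed_policy G \<delta> u u'))"
  define d where "d = (\<lambda>\<delta>. team_mean G \<nu> (mixed_policy G \<delta> u u') - team_mean G \<nu> (det_policy G u))"
  define gap where "gap = (\<lambda>i s. Q u i s (u' i s) - Q u i s (u i s))"
  define A where "A = (\<lambda>\<delta>. \<Sum>i\<in>I. player_avg i \<delta> (u i) (u' i) (gap i))"
  have J0: "J 0 = team_variance G \<nu> (det_policy G u)" by (simp add: J_def mixed_policy_zero)
  obtain C where C: "\<And>\<delta>. 0 \<le> \<delta> \<Longrightarrow> \<delta> \<le> 1/2 \<Longrightarrow> \<bar>d \<delta>\<bar> \<le> C * \<delta>"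
    using mean_lipschitz[OF u u'] unfolding d_def by blast
  have d2: "n * (d \<delta>)\<^sup>2 \<le> n * C\<^sup>2 * \<delta>\<^sup>2" if "0 \<le> \<delta>" "\<delta> \<le> 1/2" for \<delta>
    using power_mono[OF C[OF that], of 2] num_players_pos
    by (simp add: power_mult_distrib mult_left_mono mult.assoc)
  have gap: "0 \<le> gap i s" if "i \<in> I" "s \<in> S i" for i s
  proof -
    have "u i s \<in> minimizers G \<nu> u i s" using fixed that by (auto simp: improvements_def)
    moreover have "u' i s \<in> actions G i" using SD_policy[OF u' that(1)] that(2) by auto
    ultimately show ?thesis by (auto simp: gap_def minimizers_def is_arg_min_linorder)
  qed
  have diff: "J \<delta> - J 0 = \<delta> * A \<delta> - n * (d \<delta>)\<^sup>2" if \<delta>: "0 \<le> \<delta>" "\<delta> \<le> 1/2" for \<delta>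
  proof -
    have "player_avg i \<delta> (u i) (u' i) (\<lambda>s. mix \<delta> (u i) (u' i) (Q u i) s - Q u i s (u i s))
        = \<delta> * player_avg i \<delta> (u i) (u' i) (gap i)" if i: "i \<in> I" for i
    proof -
      obtain m \<epsilon> where "minorized_chain (S i) (W i \<delta> (u i) (u' i)) m \<epsilon>"
        using minorized[OF i SD_policy[OF u i] SD_policy[OF u' i] \<delta>] .
      then interpret minorized_chain "S i" "W i \<delta> (u i) (u' i)" m \<epsilon> .
      have "(\<lambda>s. mix \<delta> (u i) (u' i) (Q u i) s - Q u i s (u i s)) = (\<lambda>s. \<delta> * gap i s + 0 * gap i s)"
        by (auto simp: mix_def gap_def algebra_simps)
      then show ?thesis unfolding player_avg_def by (simp only: stat_avg_linear)
    qed
    then show ?thesis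
      unfolding J0 unfolding J_def variance_difference[OF u u u' \<delta>] A_def d_def
      by (simp add: sum_distrib_left)
  qed
  show ?thesis
  proof (cases "\<exists>i\<in>I. \<exists>s\<in>S i. 0 < gap i s")
    case True
    then obtain j s where js: "j \<in> I" "s \<in> S j" "0 < gap j s" by blast
    obtain m \<epsilon> where \<epsilon>: "\<epsilon> > 0" and minor: "\<And>v' \<delta>. v' \<in> U j \<Longrightarrow> 0 \<le> \<delta> \<Longrightarrow> \<delta> \<le> 1/2 \<Longrightarrow>
        minorized_chain (S j) (W j \<delta> (u j) v') m \<epsilon>"
      using player_minorization[OF js(1) SD_policy[OF u js(1)]] by metis
    define \<kappa> where "\<kappa> = \<epsilon> * gap j s"
    have \<kappa>: "\<kappa> > 0" using \<epsilon> js by (simp add: \<kappa>_def)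
    have A: "\<kappa> \<le> A \<delta>" if \<delta>: "0 \<le> \<delta>" "\<delta> \<le> 1/2" for \<delta>
    proof -
      have "0 \<le> player_avg i \<delta> (u i) (u' i) (gap i)" if i: "i \<in> I" for i
      proof -
        obtain m \<epsilon> where "minorized_chain (S i) (W i \<delta> (u i) (u' i)) m \<epsilon>"
          using minorized[OF i SD_policy[OF u i] SD_policy[OF u' i] \<delta>] .
        then interpret minorized_chain "S i" "W i \<delta> (u i) (u' i)" m \<epsilon> .
        show ?thesis using stat_avg_mono[of "\<lambda>_. 0" "gap i"] gap[OF i]
          by (simp add: stat_avg_const player_avg_def)
      qed
      then have "player_avg j \<delta> (u j) (u' j) (gap j) \<le> A \<delta>"
        unfolding A_def using finite_players js(1)
        by (intro member_le_sum[where f = "\<lambda>i. player_avg i \<delta> (u i) (u' i) (gap i)"]) auto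
      moreover have "\<kappa> \<le> player_avg j \<delta> (u j) (u' j) (gap j)"
      proof -
        interpret minorized_chain "S j" "W j \<delta> (u j) (u' j)" m \<epsilon>
          using SD_policy[OF u' js(1)] \<delta> by (rule minor)
        show ?thesis unfolding \<kappa>_def player_avg_def using gap[OF js(1)] js(2) by (rule stat_avg_lower)
      qed
      ultimately show ?thesis by linarith
    qed
    \<comment> \<open>Below this bound the linear gain \<open>\<kappa> * \<delta>\<close> exceeds the quadratic loss \<open>n * C\<^sup>2 * \<delta>\<^sup>2\<close>; the added
      \<open>1\<close> keeps the denominator positive when \<open>C = 0\<close>.\<close>
    define \<delta>0 where "\<delta>0 = min (1/2) (\<kappa> / (n * C\<^sup>2 + 1))"
    have den: "0 < n * C\<^sup>2 + 1" using num_players_pos by (simp add: add_nonneg_pos)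
    have "J 0 < J \<delta>" if \<delta>: "0 < \<delta>" "\<delta> < \<delta>0" for \<delta>
    proof -
      have half: "0 \<le> \<delta>" "\<delta> \<le> 1/2" using \<delta> by (auto simp: \<delta>0_def)
      have "\<delta> * (n * C\<^sup>2 + 1) < \<kappa>" using \<delta> den by (simp add: \<delta>0_def pos_less_divide_eq)
      then have "n * C\<^sup>2 * \<delta> < \<kappa>" using \<delta> by (simp add: algebra_simps)
      then have "n * C\<^sup>2 * \<delta> * \<delta> < \<kappa> * \<delta>" using \<delta>(1) by (intro mult_strict_right_mono)
      moreover have "\<kappa> * \<delta> \<le> \<delta> * A \<delta>" using A[OF half] \<delta>(1) by (simp add: mult.commute)
      ultimately show ?thesis
        using diff[OF half] d2[OF half] by (simp add: power2_eq_square mult.assoc)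
    qed
    then have "strict_local_min_along G \<nu> u u'"
      unfolding strict_local_min_along_def using \<kappa> den
      by (intro exI[of _ \<delta>0]) (auto simp: \<delta>0_def J_def J0[symmetric, unfolded J_def])
    then show ?thesis ..
  next
    case False
    have J: "\<bar>J \<delta> - J 0\<bar> \<le> n * C\<^sup>2 * \<delta>\<^sup>2" if \<delta>: "0 \<le> \<delta>" "\<delta> \<le> 1/2" for \<delta>
    proof -
      have "player_avg i \<delta> (u i) (u' i) (gap i) = 0" if i: "i \<in> I" for i
      proof -
        obtain m \<epsilon> where "minorized_chain (S i) (W i \<delta> (u i) (u' i)) m \<epsilon>"
          using minorized[OF i SD_policy[OF u i] SD_policy[OF u' i] \<delta>] .
        then interpret minorized_chain "S i" "W i \<delta> (u i) (u' i)" m \<epsilon> .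
        have "gap i s = 0" if "s \<in> S i" for s using gap[OF i that] False i that by force
        then have "stat_avg (gap i) = stat_avg (\<lambda>_. 0)" by (rule stat_avg_cong)
        then show ?thesis by (simp add: stat_avg_const player_avg_def)
      qed
      then have "J \<delta> - J 0 = - (n * (d \<delta>)\<^sup>2)" using diff[OF \<delta>] by (simp add: A_def)
      then show ?thesis using d2[OF \<delta>] num_players_pos by simp
    qed
    have "((\<lambda>\<delta>. (J \<delta> - J 0) / (\<delta> - 0)) \<longlongrightarrow> 0) (at 0 within {0..1})"
    proof (rule Lim_null_comparison)
      show "\<forall>\<^sub>F \<delta> in at 0 within {0..1}. norm ((J \<delta> - J 0) / (\<delta> - 0)) \<le> n * C\<^sup>2 * \<delta>"
        unfolding eventually_at
      proof (intro exI[of _ "1/2"] conjI ballI impI)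
        fix \<delta> :: real assume "\<delta> \<in> {0..1}" "\<delta> \<noteq> 0 \<and> dist \<delta> 0 < 1/2"
        then have \<delta>: "0 < \<delta>" "\<delta> \<le> 1/2" by auto
        then show "norm ((J \<delta> - J 0) / (\<delta> - 0)) \<le> n * C\<^sup>2 * \<delta>"
          using J[of \<delta>] by (simp add: divide_le_eq power2_eq_square mult.assoc)
      qed simp
      show "((\<lambda>\<delta>. n * C\<^sup>2 * \<delta>) \<longlongrightarrow> 0) (at 0 within {0..1})"
        by (rule tendsto_eq_rhs[OF tendsto_mult[OF tendsto_const tendsto_ident_at]]) simp
    qed
    then have "stationary_along G \<nu> u u'"
      unfolding stationary_along_def has_field_derivative_iff J_def .
    then show ?thesis ..
  qed
qed

text \<open>A run that never stopped would visit pairwise different policies, since the variance strictly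
  decreases along it.\<close>
theorem run_stops:
  assumes run: "algorithm_run G \<nu> V"
  shows "\<exists>L. stops_at V L \<and> V L \<in> SD_policies G"
proof -
  have SD: "V l \<in> SD_policies G" if "\<forall>k<l. V (Suc k) \<noteq> V k" for l
  proof (cases l)
    case (Suc l')
    then have "V (Suc l') \<in> improvements G \<nu> (V l')"
      using run that unfolding algorithm_run_def by auto
    then show ?thesis using Suc by (auto simp: improvements_def)
  qed (use run in \<open>simp add: algorithm_run_def\<close>)
  have "\<exists>l. V (Suc l) = V l"
  proof (rule ccontr)
    assume "\<not> ?thesis"
    then have never: "V (Suc l) \<noteq> V l" for l by blast
    define J where "J = (\<lambda>l. team_variance G \<nu> (det_policy G (V l)))"
    have "J (Suc l) < J l" for l
      using run never SD unfolding J_def algorithm_run_def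
      by (intro improvement_decreases_variance) auto
    then have "strict_mono (\<lambda>l. - J l)" by (intro strict_mono_Suc_iff[THEN iffD2]) auto
    then have "inj (\<lambda>l. - J l)" by (rule strict_mono_imp_inj_on)
    then have "inj V" by (auto simp: inj_def J_def)
    moreover have "finite (range V)"
    proof (rule finite_subset)
      show "range V \<subseteq> SD_policies G" using SD never by auto
      show "finite (SD_policies G)"
        unfolding SD_policies_def using finite_players player_facts by (intro finite_PiE) auto
    qed
    ultimately show False using finite_imageD by blast
  qed
  then obtain l where "V (Suc l) = V l" ..
  then have "stops_at V (LEAST l. V (Suc l) = V l)"
    unfolding stops_at_def using LeastI[of "\<lambda>l. V (Suc l) = V l"] not_less_Least by blast
  then show ?thesis using SD unfolding stops_at_def by blast
qed

end

theorem theorem5: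
  fixes G :: "('s, 'a) game"
    and \<nu> :: "(nat \<Rightarrow> 's) pmf"
    and U :: "nat \<Rightarrow> nat \<Rightarrow> 's \<Rightarrow> 'a"
  assumes "valid_game G"
    and "ergodic_game G"
    and "set_pmf \<nu> \<subseteq> joint_states G"
    and "algorithm_run G \<nu> U"
  shows "\<exists>L. stops_at U L \<and> U L \<in> SD_policies G \<and>
           (\<forall>u'\<in>SD_policies G.
              strict_local_min_along G \<nu> (U L) u' \<or> stationary_along G \<nu> (U L) u')"
proof -
  interpret game: separated_game G \<nu> using assms(1-3) by unfold_locales
  obtain L where L: "stops_at U L" "U L \<in> SD_policies G"
    using game.run_stops[OF assms(4)] by blast
  have "U (Suc L) \<in> improvements G \<nu> (U L)" "U (Suc L) = U L"
    using assms(4) L(1) by (auto simp: algorithm_run_def stops_at_def)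
  then have "U L \<in> improvements G \<nu> (U L)" by simp
  then show ?thesis using L game.fixed_point_optimality by blast
qed

end
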